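(* Let $\alpha_0,\ldots,\alpha_6$ be complex parameters with $\alpha_0+\alpha_1+2\alpha_2+3\alpha_3+2\alpha_4+\alpha_5+2\alpha_6=1$, and consider the Hamiltonian system $$s(s-1)\frac{dq_i}{ds}=\{H,q_i\},\qquad s(s-1)\frac{dp_i}{ds}=\{H,p_i\}\qquad (i=1,2,3),$$ with the Poisson bracket $\{p_i,q_j\}=\delta_{i,j}$, $\{p_i,p_j\}=\{q_i,q_j\}=0$ and the Hamiltonian $$\begin{aligned}H&=H_{\rm VI}(p_1,q_1,s;\alpha_3,1-\alpha_1-2\alpha_2-2\alpha_3,\alpha_1,\alpha_3)\\&\quad+H_{\rm VI}(p_2,q_2,s;\alpha_3,1-2\alpha_3-2\alpha_4-\alpha_5,\alpha_5,\alpha_3)\\&\quad+H_{\rm VI}(p_3,q_3,s;\alpha_3,1-\alpha_0-2\alpha_3-2\alpha_6,\alpha_0,\alpha_3)\\&\quad+\sum_{1\le i<j\le 3}\{(q_i-1)p_i+\alpha_{2i}\}\{(q_j-1)p_j+\alpha_{2j}\}(q_iq_j+s).\end{aligned}$$ Put $$\varphi_0=q_3-1,\quad \varphi_1=q_1-1,\quad \varphi_2=p_1,\quad \varphi_3=q_1q_2q_3-s,\quad \varphi_4=p_2,\quad \varphi_5=q_2-1,\quad \varphi_6=p_3.$$ Then this Hamiltonian system is invariant under the action of the birational canonical transformations $r_i$ $(i=0,\ldots,6)$ and $\pi_i$ $(i=1,2)$ defined by $$r_i(\alpha_j)=\alpha_j-a_{ij}\alpha_i,\qquad r_i(\varphi_j)=\varphi_j+\frac{\alpha_i}{\varphi_i}\{\varphi_i,\varphi_j\}\qquad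 (i,j=0,\ldots,6),$$ and $$\pi_i(\alpha_j)=\alpha_{\sigma_i(j)},\qquad \pi_i(\varphi_j)=\varphi_{\sigma_i(j)}\qquad (i=1,2;\ j=0,\ldots,6),$$ where $\sigma_1=(0\,1)(2\,6)$ and $\sigma_2=(0\,5)(4\,6)$ are permutations of $\{0,\ldots,6\}$ and $(a_{ij})_{i,j=0}^6$ is the generalized Cartan matrix of type $E_6^{(1)}$.
   Context: The Painlevé VI Hamiltonian is $$H_{\rm VI}(p,q,s;\beta_0,\beta_1,\beta_3,\beta_4)=q(q-1)(q-s)p^2-\{(\beta_1-1)q(q-1)+\beta_3q(q-s)+\beta_4(q-1)(q-s)\}p+\beta_2(\beta_0+\beta_2)q,$$ where $\beta_2$ is determined by $\beta_0+\beta_1+2\beta_2+\beta_3+\beta_4=1$. (So in the three summands of $H$ one has $\beta_2=\alpha_2$, $\alpha_4$, $\alpha_6$ respectively.) The generalized Cartan matrix of type $E_6^{(1)}$, rows and columns indexed by $0,\ldots,6$, is $$(a_{ij})=\begin{bmatrix}2&0&0&0&0&0&-1\\0&2&-1&0&0&0&0\\0&-1&2&-1&0&0&0\\0&0&-1&2&-1&0&-1\\0&0&0&-1&2&-1&0\\0&0&0&0&-1&2&0\\-1&0&0&-1&0&0&2\end{bmatrix}.$$ The transformations act on rational functions in $q_1,q_2,q_3,p_1,p_2,p_3,s$ and the parameters $\alpha_0,\ldots,\alpha_6$ (subject to the linear relation) and fix $s$. Since $q_1,q_2,q_3,p_1,p_2,p_3$ are, up to additive constants, among the $\varphi_j$,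 the given formulas determine the action on all variables; the formula for $\varphi_3$ is consistent with them. "Canonical" means preserving the Poisson bracket. "The system is invariant" under a transformation $w$ means that the transformed variables $w(q_i),w(p_i)$ satisfy, as a consequence of the system with parameters $\alpha_j$, the same Hamiltonian system with the parameters $\alpha_j$ replaced by $w(\alpha_j)$; equivalently, $w$ commutes with the derivation $d/ds$ defined by the system. *)

theory Defs
  imports
    Complex_Main
    "HOL-Library.Poly_Mapping"
    "HOL-Computational_Algebra.Fraction_Field"
    "HOL-Combinatorics.Transposition"
begin

section \<open>Rational functions in several variables\<close>

text \<open>
  The field of rational functions over \<open>'k\<close> in the variables \<open>'v\<close>: the fraction field of
  the polynomial ring, whose elements map exponent vectors to coefficients.  The library makes
  this ring an integral domain if \<open>'v\<close> is linearly ordered; the order has no other role.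
\<close>

type_synonym ('v, 'k) mpol = "('v \<Rightarrow>\<^sub>0 nat) \<Rightarrow>\<^sub>0 'k"
type_synonym ('v, 'k) ratfun = "('v, 'k) mpol fract"

definition Const :: "'k::idom \<Rightarrow> ('v::linorder, 'k) ratfun" where
  "Const c = Fract (Poly_Mapping.single 0 c) 1"

definition Var :: "'v \<Rightarrow> ('v::linorder, 'k::idom) ratfun" where
  "Var v = Fract (Poly_Mapping.single (Poly_Mapping.single v 1) 1) 1"

definition mpol_deriv :: "'v \<Rightarrow> ('v, 'k::comm_semiring_1) mpol \<Rightarrow> ('v, 'k) mpol" where
  "mpol_deriv v p =
     (\<Sum>m\<in>Poly_Mapping.keys p.
        Poly_Mapping.single (m - Poly_Mapping.single v 1)
          (of_nat (Poly_Mapping.lookup m v) * Poly_Mapping.lookup p m))"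

lemma mpol_deriv_superset:
  assumes "finite A" "Poly_Mapping.keys p \<subseteq> A"
  shows "mpol_deriv v p =
     (\<Sum>m\<in>A. Poly_Mapping.single (m - Poly_Mapping.single v 1)
          (of_nat (Poly_Mapping.lookup m v) * Poly_Mapping.lookup p m))"
  unfolding mpol_deriv_def
  by (rule sum.mono_neutral_left) (use assms in \<open>auto simp: in_keys_iff\<close>)

lemma mpol_deriv_add: "mpol_deriv v (p + q) = mpol_deriv v p + mpol_deriv v q"
proof -
  let ?A = "Poly_Mapping.keys p \<union> Poly_Mapping.keys q"
  have "Poly_Mapping.keys (p + q) \<subseteq> ?A"
    by (rule keys_add)
  then show ?thesis
    by (simp add: mpol_deriv_superset[of ?A] lookup_add distrib_left single_add sum.distrib)
qed

lemma mpol_deriv_zero [simp]: "mpol_deriv v 0 = 0"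
  by (simp add: mpol_deriv_def)

lemma mpol_deriv_sum: "mpol_deriv v (\<Sum>i\<in>I. f i) = (\<Sum>i\<in>I. mpol_deriv v (f i))"
  by (induction I rule: infinite_finite_induct) (simp_all add: mpol_deriv_add)

lemma mpol_deriv_single:
  "mpol_deriv v (Poly_Mapping.single m c) =
     Poly_Mapping.single (m - Poly_Mapping.single v 1) (of_nat (Poly_Mapping.lookup m v) * c)"
  by (cases "c = 0") (simp_all add: mpol_deriv_def)

lemma mpol_sum_monomials:
  "p = (\<Sum>m\<in>Poly_Mapping.keys p. Poly_Mapping.single m (Poly_Mapping.lookup p m))"
  by (rule poly_mapping_eqI)
     (auto simp: lookup_sum lookup_single when_def in_keys_iff sum.delta)

lemma mpol_deriv_mult_single:
  fixes c d :: "'k::comm_semiring_1"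
  shows "mpol_deriv v (Poly_Mapping.single m c * Poly_Mapping.single n d) =
     mpol_deriv v (Poly_Mapping.single m c) * Poly_Mapping.single n d +
     Poly_Mapping.single m c * mpol_deriv v (Poly_Mapping.single n d)"
proof -
  let ?e = "Poly_Mapping.single v (1::nat)"
  have 1: "m + n - ?e = (m - ?e) + n" if "Poly_Mapping.lookup m v \<noteq> 0"
    by (rule poly_mapping_eqI) (use that in \<open>auto simp: lookup_add lookup_minus lookup_single when_def\<close>)
  have 2: "m + n - ?e = m + (n - ?e)" if "Poly_Mapping.lookup n v \<noteq> 0"
    by (rule poly_mapping_eqI) (use that in \<open>auto simp: lookup_add lookup_minus lookup_single when_def\<close>)
  show ?thesis
    using 1 2
    by (cases "Poly_Mapping.lookup m v = 0"; cases "Poly_Mapping.lookup n v = 0")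
       (auto simp: mult_single mpol_deriv_single lookup_add algebra_simps simp flip: single_add)
qed

lemma mpol_deriv_mult:
  fixes p q :: "('v, 'k::comm_semiring_1) mpol"
  shows "mpol_deriv v (p * q) = mpol_deriv v p * q + p * mpol_deriv v q"
proof -
  let ?P = "\<lambda>m. Poly_Mapping.single m (Poly_Mapping.lookup p m)"
  let ?Q = "\<lambda>m. Poly_Mapping.single m (Poly_Mapping.lookup q m)"
  have "mpol_deriv v (sum ?P I * sum ?Q J) =
      mpol_deriv v (sum ?P I) * sum ?Q J + sum ?P I * mpol_deriv v (sum ?Q J)" for I J
    by (simp add: sum_product mpol_deriv_sum mpol_deriv_mult_single sum.distrib)
  from this[of "Poly_Mapping.keys p" "Poly_Mapping.keys q"] show ?thesis
    by (simp flip: mpol_sum_monomials)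
qed

lift_definition pderivative ::
    "'v::linorder \<Rightarrow> ('v, 'k::idom) ratfun \<Rightarrow> ('v, 'k) ratfun"
  is "\<lambda>v x. (mpol_deriv v (fst x) * snd x - fst x * mpol_deriv v (snd x), snd x * snd x)"
proof -
  fix v :: 'v and x y :: "('v, 'k) mpol \<times> ('v, 'k) mpol"
  obtain a b c d where xy: "x = (a, b)" "y = (c, d)"
    by (metis surj_pair)
  assume "fractrel x y"
  then have bd: "b \<noteq> 0" "d \<noteq> 0" and eq: "a * d = c * b"
    by (auto simp: xy)
  let ?D = "mpol_deriv v"
  have "?D a * d + a * ?D d = ?D c * b + c * ?D b"
    using arg_cong[OF eq, of ?D] by (simp add: mpol_deriv_mult)
  then have "(?D a * d + a * ?D d) * (b * d) = (?D c * b + c * ?D b) * (b * d)"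
    by simp
  moreover have "(?D a * b - a * ?D b) * (d * d) - (?D c * d - c * ?D d) * (b * b) =
      (?D a * d + a * ?D d) * (b * d) - (?D c * b + c * ?D b) * (b * d)
      - (a * d - c * b) * (?D b * d + b * ?D d)"
    by (simp add: algebra_simps)
  ultimately have "(?D a * b - a * ?D b) * (d * d) - (?D c * d - c * ?D d) * (b * b) = 0"
    by (simp only: eq) simp
  then have "(?D a * b - a * ?D b) * (d * d) = (?D c * d - c * ?D d) * (b * b)"
    by (simp only: right_minus_eq)
  with bd show "fractrel (?D (fst x) * snd x - fst x * ?D (snd x), snd x * snd x)
      (?D (fst y) * snd y - fst y * ?D (snd y), snd y * snd y)"
    by (simp add: xy)
qed

lemma pderivative_Fract:
  "b \<noteq> 0 \<Longrightarrow>
   pderivative v (Fract a b) = Fract (mpol_deriv v a * b - a * mpol_deriv v b) (b * b)"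
  by transfer simp

lemma mpol_deriv_one [simp]: "mpol_deriv v 1 = 0"
  unfolding single_one[symmetric] mpol_deriv_single by simp

lemma pderivative_Fract_one: "pderivative v (Fract a 1) = Fract (mpol_deriv v a) 1"
  by (simp add: pderivative_Fract)

lemma pderivative_Const [simp]: "pderivative v (Const c) = 0"
  by (simp add: Const_def pderivative_Fract_one mpol_deriv_single fract_collapse)

lemma pderivative_Var:
  "pderivative v (Var u :: ('v::linorder, 'k::idom) ratfun) = (if u = v then 1 else 0)"
  by (simp add: Var_def pderivative_Fract_one mpol_deriv_single fract_collapse
      lookup_single when_def)

definition field_hom :: "('a::field \<Rightarrow> 'b::field) \<Rightarrow> bool" where
  "field_hom w \<longleftrightarrow> w 1 = 1 \<and> (\<forall>x y. w (x + y) = w x + w y) \<and> (\<forall>x y. w (x * y) = w x * w y)"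

section \<open>The phase space and its Poisson bracket\<close>

datatype coord = Q1 | Q2 | Q3 | P1 | P2 | P3 | Sv

fun coord_rank :: "coord \<Rightarrow> nat" where
  "coord_rank Q1 = 0" | "coord_rank Q2 = 1" | "coord_rank Q3 = 2"
| "coord_rank P1 = 3" | "coord_rank P2 = 4" | "coord_rank P3 = 5" | "coord_rank Sv = 6"

instantiation coord :: linorder
begin
definition less_eq_coord :: "coord \<Rightarrow> coord \<Rightarrow> bool" where
  "less_eq_coord x y \<longleftrightarrow> coord_rank x \<le> coord_rank y"
definition less_coord :: "coord \<Rightarrow> coord \<Rightarrow> bool" where
  "less_coord x y \<longleftrightarrow> coord_rank x < coord_rank y"
instance
proof
  fix x y :: coord
  show "x \<le> y \<Longrightarrow> y \<le> x \<Longrightarrow> x = y"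
    by (cases x; cases y) (simp_all add: less_eq_coord_def)
qed (auto simp: less_eq_coord_def less_coord_def)
end

text \<open>
  The constant field \<open>'k\<close> contains the parameters: it is \<open>complex\<close> when these are complex
  numbers, and the field of rational functions in the parameters when these are indeterminates.
\<close>

type_synonym 'k phase = "(coord, 'k) ratfun"

definition q_coord :: "nat \<Rightarrow> coord" where
  "q_coord i = (if i = 1 then Q1 else if i = 2 then Q2 else Q3)"

definition p_coord :: "nat \<Rightarrow> coord" where
  "p_coord i = (if i = 1 then P1 else if i = 2 then P2 else P3)"

abbreviation qv :: "nat \<Rightarrow> 'k::field phase" where "qv i \<equiv> Var (q_coord i)"
abbreviation pv :: "nat \<Rightarrow> 'k::field phase" where "pv i \<equiv> Var (p_coord i)"
abbreviation sv :: "'k::field phase" where "sv \<equiv> Var Sv"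

definition poisson :: "'k::field phase \<Rightarrow> 'k phase \<Rightarrow> 'k phase" where
  "poisson f g =
     (\<Sum>i\<in>{1..3}. pderivative (p_coord i) f * pderivative (q_coord i) g
                 - pderivative (q_coord i) f * pderivative (p_coord i) g)"

lemma poisson_coords:
  assumes "i \<in> {1..3}" "j \<in> {1..3}"
  shows "poisson (pv i) (qv j) = (if i = j then 1 else 0)"
    and "poisson (pv i) (pv j) = 0" and "poisson (qv i) (qv j) = 0"
proof -
  have I: "{1..3} = {1, 2, 3 :: nat}" "{Suc 0..3} = {1, 2, 3 :: nat}" by auto
  have "i = 1 \<or> i = 2 \<or> i = 3" "j = 1 \<or> j = 2 \<or> j = 3" using assms by auto
  then show "poisson (pv i) (qv j) = (if i = j then 1 else 0)"
    and "poisson (pv i) (pv j) = 0" and "poisson (qv i) (qv j) = 0"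
    by (auto simp: I poisson_def pderivative_Var q_coord_def p_coord_def)
qed

section \<open>The Hamiltonian system\<close>

definition H_VI :: "'a::field \<Rightarrow> 'a \<Rightarrow> 'a \<Rightarrow> 'a \<Rightarrow> 'a \<Rightarrow> 'a \<Rightarrow> 'a \<Rightarrow> 'a" where
  "H_VI p q s \<beta>0 \<beta>1 \<beta>3 \<beta>4 =
    (let \<beta>2 = (1 - \<beta>0 - \<beta>1 - \<beta>3 - \<beta>4) / 2 in
      q * (q - 1) * (q - s) * p^2
      - ((\<beta>1 - 1) * q * (q - 1) + \<beta>3 * q * (q - s) + \<beta>4 * (q - 1) * (q - s)) * p
      + \<beta>2 * (\<beta>0 + \<beta>2) * q)"

definition param_relation :: "(nat \<Rightarrow> 'k::comm_ring_1) \<Rightarrow> bool" where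
  "param_relation \<alpha> \<longleftrightarrow>
     \<alpha> 0 + \<alpha> 1 + 2 * \<alpha> 2 + 3 * \<alpha> 3 + 2 * \<alpha> 4 + \<alpha> 5 + 2 * \<alpha> 6 = 1"

definition hamiltonian :: "(nat \<Rightarrow> 'k::field) \<Rightarrow> 'k phase" where
  "hamiltonian \<alpha> =
    (let a = (\<lambda>j. Const (\<alpha> j)) in
      H_VI (pv 1) (qv 1) sv (a 3) (1 - a 1 - 2 * a 2 - 2 * a 3) (a 1) (a 3)
    + H_VI (pv 2) (qv 2) sv (a 3) (1 - 2 * a 3 - 2 * a 4 - a 5) (a 5) (a 3)
    + H_VI (pv 3) (qv 3) sv (a 3) (1 - a 0 - 2 * a 3 - 2 * a 6) (a 0) (a 3)
    + (\<Sum>(i, j)\<in>{(i, j). 1 \<le> i \<and> i < j \<and> j \<le> 3}.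
        ((qv i - 1) * pv i + a (2 * i)) * ((qv j - 1) * pv j + a (2 * j)) * (qv i * qv j + sv)))"

text \<open>
  The derivation \<open>d/ds\<close> defined by the system with parameters \<open>\<alpha>\<close>: it is trivial on the
  constants \<open>'k\<close>, maps \<open>sv\<close> to \<open>1\<close>, and maps \<open>qv i\<close> and \<open>pv i\<close> to the right-hand sides of the
  equations, divided by \<open>sv * (sv - 1)\<close>.
\<close>

definition ddt :: "(nat \<Rightarrow> 'k::field) \<Rightarrow> 'k phase \<Rightarrow> 'k phase" where
  "ddt \<alpha> f =
     pderivative Sv f
     + (\<Sum>i\<in>{1..3}. poisson (hamiltonian \<alpha>) (qv i) / (sv * (sv - 1)) * pderivative (q_coord i) f
                 + poisson (hamiltonian \<alpha>) (pv i) / (sv * (sv - 1)) * pderivative (p_coord i) f)"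

lemma ddt_system:
  assumes "i \<in> {1..3}"
  shows "sv * (sv - 1) * ddt \<alpha> (qv i) = poisson (hamiltonian \<alpha>) (qv i)"
    and "sv * (sv - 1) * ddt \<alpha> (pv i) = poisson (hamiltonian \<alpha>) (pv i)"
    and "ddt \<alpha> sv = 1" and "ddt \<alpha> (Const c) = 0"
proof -
  have I: "{1..3} = {1, 2, 3 :: nat}" "{Suc 0..3} = {1, 2, 3 :: nat}" by auto
  have "sv \<noteq> (0 :: 'a phase)" "sv \<noteq> (1 :: 'a phase)"
    using pderivative_Var[of Sv Sv, where 'k = 'a] pderivative_Const[of Sv "0 :: 'a"]
      pderivative_Const[of Sv "1 :: 'a"]
    by (auto simp: Const_def fract_collapse)
  moreover have "i = 1 \<or> i = 2 \<or> i = 3" using assms by auto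
  ultimately show "sv * (sv - 1) * ddt \<alpha> (qv i) = poisson (hamiltonian \<alpha>) (qv i)"
    and "sv * (sv - 1) * ddt \<alpha> (pv i) = poisson (hamiltonian \<alpha>) (pv i)"
    and "ddt \<alpha> sv = 1" and "ddt \<alpha> (Const c) = 0"
    by (auto simp: I ddt_def pderivative_Var q_coord_def p_coord_def)
qed

section \<open>The transformations\<close>

text \<open>The generalized Cartan matrix of type \<open>E\<^sub>6\<^sup>(\<^sup>1\<^sup>)\<close>.\<close>

definition cartan :: "nat \<Rightarrow> nat \<Rightarrow> int" where
  "cartan i j =
    [[ 2,  0,  0,  0,  0,  0, -1],
     [ 0,  2, -1,  0,  0,  0,  0],
     [ 0, -1,  2, -1,  0,  0,  0],
     [ 0,  0, -1,  2, -1,  0, -1],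
     [ 0,  0,  0, -1,  2, -1,  0],
     [ 0,  0,  0,  0, -1,  2,  0],
     [-1,  0,  0, -1,  0,  0,  2]] ! i ! j"

definition \<phi> :: "nat \<Rightarrow> 'k::field phase" where
  "\<phi> j = [qv 3 - 1, qv 1 - 1, pv 1, qv 1 * qv 2 * qv 3 - sv, pv 2, qv 2 - 1, pv 3] ! j"

definition r_param :: "nat \<Rightarrow> (nat \<Rightarrow> 'k::field) \<Rightarrow> nat \<Rightarrow> 'k" where
  "r_param i \<alpha> j = \<alpha> j - of_int (cartan i j) * \<alpha> i"

definition r_phi :: "nat \<Rightarrow> (nat \<Rightarrow> 'k::field) \<Rightarrow> nat \<Rightarrow> 'k phase" where
  "r_phi i \<alpha> j = \<phi> j + Const (\<alpha> i) / \<phi> i * poisson (\<phi> i) (\<phi> j)"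

definition \<sigma>1 :: "nat \<Rightarrow> nat" where "\<sigma>1 = transpose 0 1 \<circ> transpose 2 6"
definition \<sigma>2 :: "nat \<Rightarrow> nat" where "\<sigma>2 = transpose 0 5 \<circ> transpose 4 6"

text \<open>
  The parameters as indeterminates subject to the linear relation: \<open>\<alpha> 1, \<dots>, \<alpha> 6\<close> are
  independent variables and \<open>\<alpha> 0\<close> is eliminated.
\<close>

datatype avar = A1 | A2 | A3 | A4 | A5 | A6

fun avar_rank :: "avar \<Rightarrow> nat" where
  "avar_rank A1 = 1" | "avar_rank A2 = 2" | "avar_rank A3 = 3"
| "avar_rank A4 = 4" | "avar_rank A5 = 5" | "avar_rank A6 = 6"

instantiation avar :: linorder
begin
definition less_eq_avar :: "avar \<Rightarrow> avar \<Rightarrow> bool" where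
  "less_eq_avar x y \<longleftrightarrow> avar_rank x \<le> avar_rank y"
definition less_avar :: "avar \<Rightarrow> avar \<Rightarrow> bool" where
  "less_avar x y \<longleftrightarrow> avar_rank x < avar_rank y"
instance
proof
  fix x y :: avar
  show "x \<le> y \<Longrightarrow> y \<le> x \<Longrightarrow> x = y"
    by (cases x; cases y) (simp_all add: less_eq_avar_def)
qed (auto simp: less_eq_avar_def less_avar_def)
end

type_synonym params = "(avar, complex) ratfun"

definition gen_alpha :: "nat \<Rightarrow> params" where
  "gen_alpha j =
    [1 - Var A1 - 2 * Var A2 - 3 * Var A3 - 2 * Var A4 - Var A5 - 2 * Var A6,
     Var A1, Var A2, Var A3, Var A4, Var A5, Var A6] ! j"

lemma param_relation_gen_alpha: "param_relation gen_alpha"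
  by (simp add: param_relation_def gen_alpha_def)

text \<open>
  Transformations acting on rational functions in the variables and the parameters:
  \<open>w\<close> sends \<open>\<alpha> j\<close> to \<open>\<beta> j\<close> and \<open>\<phi> j\<close> to \<open>\<psi> j\<close>, and fixes \<open>s\<close> and the complex numbers.
\<close>

definition generic_transf ::
    "(nat \<Rightarrow> params) \<Rightarrow> (nat \<Rightarrow> params phase) \<Rightarrow> (params phase \<Rightarrow> params phase) \<Rightarrow> bool" where
  "generic_transf \<beta> \<psi> w \<longleftrightarrow>
     field_hom w \<and> (\<forall>c. w (Const (Const c)) = Const (Const c)) \<and>
     (\<forall>j\<le>6. w (Const (gen_alpha j)) = Const (\<beta> j)) \<and>
     w sv = sv \<and> (\<forall>j\<le>6. w (\<phi> j) = \<psi> j)"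

text \<open>
  Transformations at fixed numerical values of the parameters.  These values are elements of
  the constant field and are not moved by \<open>w\<close>; their change enters through the systems that
  \<open>w\<close> relates (see \<open>symmetry\<close> below).
\<close>

definition numeric_transf ::
    "(nat \<Rightarrow> complex phase) \<Rightarrow> (complex phase \<Rightarrow> complex phase) \<Rightarrow> bool" where
  "numeric_transf \<psi> w \<longleftrightarrow>
     field_hom w \<and> (\<forall>c. w (Const c) = Const c) \<and> w sv = sv \<and> (\<forall>j\<le>6. w (\<phi> j) = \<psi> j)"

definition birational_canonical :: "('k::field phase \<Rightarrow> 'k phase) \<Rightarrow> bool" where
  "birational_canonical w \<longleftrightarrow>
     bij w \<and> (\<forall>f g. w (poisson f g) = poisson (w f) (w g))"

text \<open>
  The formulas \<open>T\<close> determine a transformation, it is birational and canonical, and it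
  intertwines the derivations \<open>d'\<close> and \<open>d\<close>.  For indeterminate parameters both derivations
  are \<open>ddt gen_alpha\<close>, so that \<open>w\<close> commutes with \<open>d/ds\<close>.  For numerical parameters \<open>\<alpha>\<close>, sent
  to \<open>\<alpha>'\<close> by the transformation, \<open>d\<close> is \<open>ddt \<alpha>\<close> and \<open>d'\<close> is \<open>ddt \<alpha>'\<close>: at \<open>f = qv i\<close> and \<open>f = pv i\<close>
  the equation then says that the \<open>w (qv i)\<close>, \<open>w (pv i)\<close> satisfy the system with parameters \<open>\<alpha>'\<close>
  as a consequence of the system with parameters \<open>\<alpha>\<close>.
\<close>

definition symmetry ::
    "(('k::field phase \<Rightarrow> 'k phase) \<Rightarrow> bool) \<Rightarrow>
     ('k phase \<Rightarrow> 'k phase) \<Rightarrow> ('k phase \<Rightarrow> 'k phase) \<Rightarrow> bool" where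
  "symmetry T d' d \<longleftrightarrow>
     (\<exists>!w. T w) \<and> (\<forall>w. T w \<longrightarrow> birational_canonical w \<and> (\<forall>f. w (d' f) = d (w f)))"

end

theory Submission
  imports Defs
begin

text \<open>
  Each transformation is a substitution with an explicit inverse of the same kind: \<open>r\<^sub>i\<close> with
  parameter \<open>c\<close> is undone by \<open>r\<^sub>i\<close> with parameter \<open>-c\<close>, because \<open>\<phi>\<^sub>i\<close> and all brackets \<open>{\<phi>\<^sub>i, x}\<close>
  with coordinates \<open>x\<close> are fixed.  Hence it extends to an automorphism of the field of rational
  functions, acting on the constants by an automorphism \<open>\<theta>\<close>; taking \<open>\<theta>\<close> to be the action on the
  parameters, respectively the identity, treats indeterminate and numerical parameters alike.
  Two derivations along a homomorphism coincide if they agree on constants and coordinates, so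
  canonicity is a statement about brackets of coordinates.  The derivation \<open>d/ds\<close> is
  \<open>\<partial>/\<partial>s + {H, _}/(s(s-1))\<close>, so invariance amounts to \<open>w(H') = H + K\<close> with
  \<open>{K, w(x)} = s(s-1) \<partial>w(x)/\<partial>s\<close> for the coordinates \<open>x\<close> of the phase space.  Here \<open>K\<close> depends on \<open>s\<close>
  alone, except for \<open>r\<^sub>3\<close>, whose explicit time dependence contributes \<open>-s(s-1) \<alpha>\<^sub>3/\<phi>\<^sub>3\<close>.
\<close>

section \<open>Homomorphisms from fields of rational functions\<close>

lemma field_hom_simps:
  assumes "field_hom w"
  shows "w 1 = 1" "w (x + y) = w x + w y" "w (x * y) = w x * w y" "w 0 = 0"
    "w (- x) = - w x" "w (x - y) = w x - w y" "w (x ^ n) = w x ^ n"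
    "w (of_int k) = of_int k" "w (numeral m) = numeral m"
    "w (inverse x) = inverse (w x)" "w (x / y) = w x / w y" "w x = 0 \<longleftrightarrow> x = 0"
proof -
  show 1: "w 1 = 1" and add: "\<And>x y. w (x + y) = w x + w y"
    and mult: "\<And>x y. w (x * y) = w x * w y"
    using assms by (auto simp: field_hom_def)
  show 0: "w 0 = 0" using add[of 0 0] by (metis add_0 add_cancel_left_right)
  show minus: "w (- x) = - w x" for x using add[of x "- x"] 0 by (simp add: eq_neg_iff_add_eq_0 add.commute)
  show diff: "w (x - y) = w x - w y" using add[of x "- y"] minus by simp
  show "w (x ^ n) = w x ^ n" by (induction n) (simp_all add: 1 mult)
  have nat: "w (of_nat n) = of_nat n" for n by (induction n) (simp_all add: 1 0 add)
  show "w (of_int k) = of_int k" by (cases k rule: int_diff_cases) (use add minus nat in \<open>metis of_int_of_nat_eq of_int_diff diff_conv_add_uminus\<close>)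
  show "w (numeral m) = numeral m" using nat[of "numeral m"] by simp
  show iff: "w x = 0 \<longleftrightarrow> x = 0" for x
  proof
    assume "w x = 0"
    then have "w (x * inverse x) = 0" by (simp add: mult)
    then show "x = 0" using 1 by (cases "x = 0") simp_all
  qed (simp add: 0)
  \<comment> \<open>At \<open>x = 0\<close> both sides vanish by the convention
    \<open>inverse 0 = 0\<close>, so the law holds for every \<open>x\<close>.\<close>
  show inv: "w (inverse x) = inverse (w x)" for x
  proof (cases "x = 0")
    case False
    then have "w x * w (inverse x) = 1" by (simp add: 1 flip: mult)
    then show ?thesis by (metis inverse_unique)
  qed (simp add: 0)
  show "w (x / y) = w x / w y" by (simp add: divide_inverse mult inv)
qed

lemma field_hom_compose: "field_hom v \<Longrightarrow> field_hom w \<Longrightarrow> field_hom (\<lambda>x. v (w x))"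
  by (simp add: field_hom_def)

lemma field_hom_id: "field_hom (\<lambda>x. x)"
  by (simp add: field_hom_def)

lemma field_hom_Const: "field_hom (Const :: 'k::field \<Rightarrow> ('v::linorder, 'k) ratfun)"
  unfolding field_hom_def
  by (simp add: Const_def single_add mult_single fract_collapse)

section \<open>Generation by constants and variables\<close>

lemma Fract_one_add: "Fract (a + b) 1 = Fract a 1 + Fract b 1"
  and Fract_one_mult: "Fract (a * b) 1 = Fract a 1 * Fract b 1"
  by simp_all

lemma Fract_conv_divide: "Fract a b = Fract a 1 / Fract b 1"
  by simp

text \<open>Constants and variables generate the polynomial ring: monomials are products of powers
  of variables, and polynomials are sums of constants times monomials.\<close>

lemma mpol_induct [case_names const var add mult]:
  fixes p :: "('v, 'k::comm_semiring_1) mpol"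
  assumes const: "\<And>c. P (Poly_Mapping.single 0 c)"
    and var: "\<And>v. P (Poly_Mapping.single (Poly_Mapping.single v 1) 1)"
    and add: "\<And>p q. P p \<Longrightarrow> P q \<Longrightarrow> P (p + q)"
    and mult: "\<And>p q. P p \<Longrightarrow> P q \<Longrightarrow> P (p * q)"
  shows "P p"
proof -
  have zero: "P 0" using const[of 0] by simp
  have one: "P 1" using const[of 1] by simp
  have mon: "P (Poly_Mapping.single m 1)" for m
  proof -
    have "P (\<Prod>v\<in>A. Poly_Mapping.single (Poly_Mapping.single v (k v)) 1)" for A and k :: "'v \<Rightarrow> nat"
    proof (induction A rule: infinite_finite_induct)
      case (insert v A)
      have "P (Poly_Mapping.single (Poly_Mapping.single v n) 1)" for n
      proof (induction n)
        case (Suc n)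
        have "Poly_Mapping.single (Poly_Mapping.single v (Suc n)) 1 =
           Poly_Mapping.single (Poly_Mapping.single v 1) (1::'k) * Poly_Mapping.single (Poly_Mapping.single v n) 1"
          by (simp add: mult_single flip: single_add)
        with mult[OF var Suc] show ?case by metis
      qed (use one in simp)
      with insert mult show ?case by simp
    qed (use one in simp_all)
    moreover have "(\<Prod>v\<in>A. Poly_Mapping.single (k v) (1::'k)) = Poly_Mapping.single (\<Sum>v\<in>A. k v) 1"
      if "finite A" for A and k :: "'v \<Rightarrow> 'v \<Rightarrow>\<^sub>0 nat"
      using that by (induction A) (simp_all add: mult_single)
    ultimately have "P (Poly_Mapping.single (\<Sum>v\<in>Poly_Mapping.keys m. Poly_Mapping.single v (Poly_Mapping.lookup m v)) 1)"
      by (metis finite_keys)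
    then show ?thesis by (simp flip: mpol_sum_monomials)
  qed
  have "P (Poly_Mapping.single m c)" for m c
    using mult[OF const[of c] mon[of m]] by (simp add: mult_single)
  then have "P (\<Sum>m\<in>A. Poly_Mapping.single m (Poly_Mapping.lookup p m))" for A
    by (induction A rule: infinite_finite_induct) (use zero add in auto)
  then show ?thesis by (metis mpol_sum_monomials)
qed

text \<open>Every rational function is a quotient of two polynomials. Thus homomorphisms, and
  likewise derivations, need only be compared on constants and variables.\<close>

lemma ratfun_induct [case_names Const Var add mult divide]:
  fixes f :: "('v::linorder, 'k::field) ratfun"
  assumes "\<And>c. P (Const c)" and "\<And>v. P (Var v)"
    and "\<And>f g. P f \<Longrightarrow> P g \<Longrightarrow> P (f + g)" and "\<And>f g. P f \<Longrightarrow> P g \<Longrightarrow> P (f * g)"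
    and "\<And>f g. P f \<Longrightarrow> P g \<Longrightarrow> g \<noteq> 0 \<Longrightarrow> P (f / g)"
  shows "P f"
proof -
  have P: "P (Fract a 1)" for a
    by (induction a rule: mpol_induct)
      (use assms(1,2) in \<open>simp_all only: Const_def Var_def Fract_one_add Fract_one_mult assms(3,4)\<close>)
  show ?thesis
  proof (cases f rule: Fract_cases)
    case (Fract a b)
    then have "Fract b 1 \<noteq> 0" by (simp add: Zero_fract_def eq_fract)
    then show ?thesis unfolding Fract(1) Fract_conv_divide[of a b] by (intro assms(5) P)
  qed
qed

lemma field_hom_ratfun_eqI:
  fixes v w :: "('v::linorder, 'k::field) ratfun \<Rightarrow> 'b::field"
  assumes "field_hom v" "field_hom w" "\<And>c. v (Const c) = w (Const c)" "\<And>x. v (Var x) = w (Var x)"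
  shows "v = w"
proof
  show "v f = w f" for f
    by (induction f rule: ratfun_induct)
      (simp_all add: assms field_hom_simps[OF assms(1)] field_hom_simps[OF assms(2)])
qed

section \<open>Substitution into polynomials and rational functions\<close>

definition mpol_eval :: "('k \<Rightarrow> 'b::comm_ring_1) \<Rightarrow> ('v \<Rightarrow> 'b) \<Rightarrow> ('v, 'k::comm_ring_1) mpol \<Rightarrow> 'b" where
  "mpol_eval \<theta> x p =
     (\<Sum>m\<in>Poly_Mapping.keys p. \<theta> (Poly_Mapping.lookup p m) *
        (\<Prod>v\<in>Poly_Mapping.keys m. x v ^ Poly_Mapping.lookup m v))"

text \<open>Coefficients are moved by \<open>\<theta>\<close> while variables are replaced, because
  the parameters lie in the constant field and may transform too.\<close>

lemma mpol_eval_hom: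
  fixes \<theta> :: "'k::field \<Rightarrow> 'b::field" and x :: "'v \<Rightarrow> 'b"
  assumes "field_hom \<theta>"
  shows "mpol_eval \<theta> x (Poly_Mapping.single 0 c) = \<theta> c"
    and "mpol_eval \<theta> x (Poly_Mapping.single (Poly_Mapping.single v 1) 1) = x v"
    and "mpol_eval \<theta> x (p + q) = mpol_eval \<theta> x p + mpol_eval \<theta> x q"
    and "mpol_eval \<theta> x (p * q) = mpol_eval \<theta> x p * mpol_eval \<theta> x q"
proof -
  note hom = field_hom_simps[OF assms]
  let ?M = "\<lambda>m. \<Prod>v\<in>Poly_Mapping.keys m. x v ^ Poly_Mapping.lookup m v"
  \<comment> \<open>Enlarging the index set only adds factors \<open>x v ^ 0 = 1\<close>, so two
    exponent vectors can be compared over one set.\<close>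
  have M_superset: "?M m = (\<Prod>v\<in>A. x v ^ Poly_Mapping.lookup m v)"
    if "finite A" "Poly_Mapping.keys m \<subseteq> A" for m A
    by (rule prod.mono_neutral_left) (use that in \<open>auto simp: in_keys_iff\<close>)
  have M_add: "?M (m + n) = ?M m * ?M n" for m n
  proof -
    let ?A = "Poly_Mapping.keys m \<union> Poly_Mapping.keys n"
    have "Poly_Mapping.keys (m + n) \<subseteq> ?A" by (rule keys_add)
    then have "?M (m + n) = (\<Prod>v\<in>?A. x v ^ Poly_Mapping.lookup (m + n) v)"
      by (intro M_superset) simp_all
    then show ?thesis
      by (simp add: M_superset[of ?A m] M_superset[of ?A n] lookup_add power_add prod.distrib)
  qed
  have superset: "mpol_eval \<theta> x p = (\<Sum>m\<in>A. \<theta> (Poly_Mapping.lookup p m) * ?M m)"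
    if "finite A" "Poly_Mapping.keys p \<subseteq> A" for p A
    unfolding mpol_eval_def
    by (rule sum.mono_neutral_left) (use that in \<open>auto simp: in_keys_iff hom\<close>)
  show add: "mpol_eval \<theta> x (p + q) = mpol_eval \<theta> x p + mpol_eval \<theta> x q" for p q
  proof -
    let ?A = "Poly_Mapping.keys p \<union> Poly_Mapping.keys q"
    have "Poly_Mapping.keys (p + q) \<subseteq> ?A" by (rule keys_add)
    then show ?thesis
      by (simp add: superset[of ?A] lookup_add hom distrib_right sum.distrib)
  qed
  have single: "mpol_eval \<theta> x (Poly_Mapping.single m c) = \<theta> c * ?M m" for m c
    by (cases "c = 0") (simp_all add: mpol_eval_def hom)
  show "mpol_eval \<theta> x (Poly_Mapping.single 0 c) = \<theta> c" by (simp add: single)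
  show "mpol_eval \<theta> x (Poly_Mapping.single (Poly_Mapping.single v 1) 1) = x v"
    by (simp add: single hom)
  have sum: "mpol_eval \<theta> x (\<Sum>i\<in>I. f i) = (\<Sum>i\<in>I. mpol_eval \<theta> x (f i))" for f and I :: "'c set"
    by (induction I rule: infinite_finite_induct) (simp_all add: add, simp_all add: mpol_eval_def)
  let ?P = "\<lambda>m. Poly_Mapping.single m (Poly_Mapping.lookup p m)"
  let ?Q = "\<lambda>m. Poly_Mapping.single m (Poly_Mapping.lookup q m)"
  \<comment> \<open>The index sets are kept arbitrary so that the monomial expansions can afterwards
    be folded back into \<open>p\<close> and \<open>q\<close>.\<close>
  have "mpol_eval \<theta> x (sum ?P I * sum ?Q J) = mpol_eval \<theta> x (sum ?P I) * mpol_eval \<theta> x (sum ?Q J)" for I J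
    by (simp add: sum_product sum mult_single single M_add hom mult_ac)
  from this[of "Poly_Mapping.keys p" "Poly_Mapping.keys q"]
  show "mpol_eval \<theta> x (p * q) = mpol_eval \<theta> x p * mpol_eval \<theta> x q"
    by (simp flip: mpol_sum_monomials)
qed

text \<open>
  The partial homomorphism obtained by substituting \<open>x\<close>: a rational function has a value if it
  is a quotient of polynomials whose denominator does not become zero.
\<close>

definition specializes ::
    "('k \<Rightarrow> 'b::field) \<Rightarrow> ('v \<Rightarrow> 'b) \<Rightarrow> ('v::linorder, 'k::field) ratfun \<Rightarrow> 'b \<Rightarrow> bool" where
  "specializes \<theta> x f g \<longleftrightarrow>
     (\<exists>a b. mpol_eval \<theta> x b \<noteq> 0 \<and> f = Fract a b \<and> g = mpol_eval \<theta> x a / mpol_eval \<theta> x b)"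

context
  fixes \<theta> :: "'k::field \<Rightarrow> 'b::field" and x :: "'v::linorder \<Rightarrow> 'b"
  assumes hom: "field_hom \<theta>"
begin

lemma mpol_eval_0_1: "mpol_eval \<theta> x 0 = 0" "mpol_eval \<theta> x 1 = 1"
  using mpol_eval_hom(1)[OF hom, of x 0] mpol_eval_hom(1)[OF hom, of x 1]
  by (simp_all add: field_hom_simps[OF hom])

lemma mpol_eval_nonzero: "mpol_eval \<theta> x b \<noteq> 0 \<Longrightarrow> b \<noteq> 0"
  using mpol_eval_0_1 by auto

text \<open>Cross-multiplying two representations of \<open>f\<close> gives a polynomial identity,
  which evaluation preserves.\<close>

lemma specializes_unique:
  assumes "specializes \<theta> x f g" "specializes \<theta> x f g'"
  shows "g = g'"
proof -
  obtain a b c d where *: "mpol_eval \<theta> x b \<noteq> 0" "f = Fract a b" "g = mpol_eval \<theta> x a / mpol_eval \<theta> x b"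
    "mpol_eval \<theta> x d \<noteq> 0" "f = Fract c d" "g' = mpol_eval \<theta> x c / mpol_eval \<theta> x d"
    using assms unfolding specializes_def by blast
  then have "a * d = c * b" by (metis eq_fract(1) mpol_eval_nonzero)
  then have "mpol_eval \<theta> x a * mpol_eval \<theta> x d = mpol_eval \<theta> x c * mpol_eval \<theta> x b"
    by (metis mpol_eval_hom(4)[OF hom])
  with * show ?thesis by (simp add: frac_eq_eq)
qed

lemma specializes_Fract_one: "specializes \<theta> x (Fract a 1) (mpol_eval \<theta> x a)"
  unfolding specializes_def by (rule exI[of _ a], rule exI[of _ 1]) (simp add: mpol_eval_0_1)

lemma specializes_Const: "specializes \<theta> x (Const c) (\<theta> c)"
  using specializes_Fract_one[of "Poly_Mapping.single 0 c"]
  by (simp add: Const_def mpol_eval_hom[OF hom])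

lemma specializes_Var: "specializes \<theta> x (Var v) (x v)"
  using specializes_Fract_one[of "Poly_Mapping.single (Poly_Mapping.single v 1) 1"]
  unfolding Var_def mpol_eval_hom(2)[OF hom] .

lemma specializes_add:
  assumes "specializes \<theta> x f g" "specializes \<theta> x f' g'"
  shows "specializes \<theta> x (f + f') (g + g')"
proof -
  obtain a b c d where *: "mpol_eval \<theta> x b \<noteq> 0" "f = Fract a b" "g = mpol_eval \<theta> x a / mpol_eval \<theta> x b"
    "mpol_eval \<theta> x d \<noteq> 0" "f' = Fract c d" "g' = mpol_eval \<theta> x c / mpol_eval \<theta> x d"
    using assms unfolding specializes_def by blast
  then show ?thesis unfolding specializes_def
    by (intro exI[of _ "a * d + c * b"] exI[of _ "b * d"])
      (simp add: mpol_eval_hom[OF hom] mpol_eval_nonzero add_frac_eq)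
qed

lemma specializes_mult:
  assumes "specializes \<theta> x f g" "specializes \<theta> x f' g'"
  shows "specializes \<theta> x (f * f') (g * g')"
proof -
  obtain a b c d where *: "mpol_eval \<theta> x b \<noteq> 0" "f = Fract a b" "g = mpol_eval \<theta> x a / mpol_eval \<theta> x b"
    "mpol_eval \<theta> x d \<noteq> 0" "f' = Fract c d" "g' = mpol_eval \<theta> x c / mpol_eval \<theta> x d"
    using assms unfolding specializes_def by blast
  then show ?thesis unfolding specializes_def
    by (intro exI[of _ "a * c"] exI[of _ "b * d"])
      (simp add: mpol_eval_hom[OF hom])
qed

lemma specializes_divide:
  assumes "specializes \<theta> x f g" "specializes \<theta> x f' g'" "g' \<noteq> 0"
  shows "specializes \<theta> x (f / f') (g / g')"
proof -
  obtain a b c d where *: "mpol_eval \<theta> x b \<noteq> 0" "f = Fract a b" "g = mpol_eval \<theta> x a / mpol_eval \<theta> x b"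
    "mpol_eval \<theta> x d \<noteq> 0" "f' = Fract c d" "g' = mpol_eval \<theta> x c / mpol_eval \<theta> x d"
    using assms unfolding specializes_def by blast
  then show ?thesis unfolding specializes_def using \<open>g' \<noteq> 0\<close>
    by (intro exI[of _ "a * d"] exI[of _ "b * c"])
      (simp add: mpol_eval_hom[OF hom])
qed

lemma specializes_of_int: "specializes \<theta> x (of_int n) (of_int n)"
  using specializes_Const[of "of_int n"]
  by (simp add: field_hom_simps[OF hom] field_hom_simps[OF field_hom_Const])

lemma specializes_numeral: "specializes \<theta> x (numeral n) (numeral n)"
  using specializes_of_int[of "numeral n"] by simp

lemma specializes_0: "specializes \<theta> x 0 0" and specializes_1: "specializes \<theta> x 1 1"
  using specializes_of_int[of 0] specializes_of_int[of 1] by simp_all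

lemma specializes_uminus: "specializes \<theta> x f g \<Longrightarrow> specializes \<theta> x (- f) (- g)"
  using specializes_mult[OF specializes_of_int[of "-1"]] by simp

lemma specializes_diff:
  "specializes \<theta> x f g \<Longrightarrow> specializes \<theta> x f' g' \<Longrightarrow> specializes \<theta> x (f - f') (g - g')"
  using specializes_add[OF _ specializes_uminus] by fastforce

lemmas specializes_intros = specializes_Const specializes_Var specializes_0 specializes_1
  specializes_numeral specializes_of_int specializes_uminus specializes_add specializes_diff
  specializes_mult specializes_divide

end

text \<open>
  Undoing the substitution \<open>x\<close> by another substitution shows that \<open>x\<close> is algebraically
  independent, so that no denominator becomes zero.
\<close>

lemma ratfun_hom_exists:
  fixes \<theta> \<theta>' :: "'k::field \<Rightarrow> 'k" and x y :: "'v::linorder \<Rightarrow> ('v, 'k) ratfun"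
  assumes hom: "field_hom \<theta>" "field_hom \<theta>'" and inv: "\<And>c. \<theta>' (\<theta> c) = c"
    and x: "\<And>v. specializes (\<lambda>c. Const (\<theta>' c)) y (x v) (Var v)"
  shows "\<exists>w. field_hom w \<and> (\<forall>f g. specializes (\<lambda>c. Const (\<theta> c)) x f g \<longleftrightarrow> w f = g)"
proof -
  let ?S = "specializes (\<lambda>c. Const (\<theta> c)) x"
  have homs: "field_hom (\<lambda>c. Const (\<theta> c) :: ('v, 'k) ratfun)" "field_hom (\<lambda>c. Const (\<theta>' c) :: ('v, 'k) ratfun)"
    using hom field_hom_compose[OF field_hom_Const] by auto
  \<comment> \<open>Evaluating at \<open>x\<close> and then substituting \<open>y\<close> respects
    sums and products, so it is enough that constants and variables come back.\<close>
  have undo: "specializes (\<lambda>c. Const (\<theta>' c)) y (mpol_eval (\<lambda>c. Const (\<theta> c)) x p) (Fract p 1)" for p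
  proof (induction p rule: mpol_induct)
    case (const c)
    then show ?case
      using specializes_Const[OF homs(2), of y "\<theta> c"]
      unfolding mpol_eval_hom(1)[OF homs(1)] inv by (simp add: Const_def)
  next
    case (var v)
    then show ?case using x[of v] unfolding mpol_eval_hom(2)[OF homs(1)] Var_def .
  next
    case (add p q)
    then show ?case
      unfolding mpol_eval_hom[OF homs(1)] Fract_one_add by (rule specializes_add[OF homs(2)])
  next
    case (mult p q)
    then show ?case
      unfolding mpol_eval_hom[OF homs(1)] Fract_one_mult by (rule specializes_mult[OF homs(2)])
  qed
  have inj: "mpol_eval (\<lambda>c. Const (\<theta> c)) x p \<noteq> 0" if "p \<noteq> 0" for p :: "('v, 'k) mpol"
  proof
    assume "mpol_eval (\<lambda>c. Const (\<theta> c)) x p = 0"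
    with undo[of p] have "Fract p 1 = 0"
      using specializes_unique[OF homs(2)] specializes_0[OF homs(2)] by metis
    with that show False by (simp add: Zero_fract_def eq_fract)
  qed
  have total: "\<exists>g. ?S f g" for f
    by (cases f rule: Fract_cases) (use inj in \<open>auto simp: specializes_def\<close>)
  \<comment> \<open>The relation is now total and single-valued, hence the graph of a
    function.\<close>
  define w where "w f = (THE g. ?S f g)" for f
  have w: "?S f g \<longleftrightarrow> w f = g" for f g
    using total[of f] specializes_unique[OF homs(1)] unfolding w_def by (metis the_equality)
  have "field_hom w"
    unfolding field_hom_def
    by (meson w specializes_1[OF homs(1)] specializes_add[OF homs(1)] specializes_mult[OF homs(1)])
  with w show ?thesis by blast
qed

text \<open>Both substitutions extend to homomorphisms, and the two composites are the identity
  because they fix constants and variables.\<close>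

theorem ratfun_automorphism:
  fixes \<theta> \<theta>' :: "'k::field \<Rightarrow> 'k" and x y :: "'v::linorder \<Rightarrow> ('v, 'k) ratfun"
  assumes hom: "field_hom \<theta>" "field_hom \<theta>'"
    and inv: "\<And>c. \<theta>' (\<theta> c) = c" "\<And>c. \<theta> (\<theta>' c) = c"
    and x: "\<And>v. specializes (\<lambda>c. Const (\<theta>' c)) y (x v) (Var v)"
    and y: "\<And>v. specializes (\<lambda>c. Const (\<theta> c)) x (y v) (Var v)"
  obtains w where "field_hom w" "bij w" "\<And>c. w (Const c) = Const (\<theta> c)" "\<And>v. w (Var v) = x v"
proof -
  have homs: "field_hom (\<lambda>c. Const (\<theta> c) :: ('v, 'k) ratfun)" "field_hom (\<lambda>c. Const (\<theta>' c) :: ('v, 'k) ratfun)"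
    using hom field_hom_compose[OF field_hom_Const] by auto
  obtain w where w: "field_hom w" "\<And>f g. specializes (\<lambda>c. Const (\<theta> c)) x f g \<longleftrightarrow> w f = g"
    using ratfun_hom_exists[OF hom inv(1) x] by blast
  obtain w' where w': "field_hom w'" "\<And>f g. specializes (\<lambda>c. Const (\<theta>' c)) y f g \<longleftrightarrow> w' f = g"
    using ratfun_hom_exists[OF hom(2,1) inv(2) y] by blast
  \<comment> \<open>Since \<open>specializes\<close> is the graph of \<open>w\<close>, the
    hypothesis on \<open>y\<close> is itself the value of \<open>w\<close> at
    \<open>y v\<close>.\<close>
  have w_gen: "w (Const c) = Const (\<theta> c)" "w (Var v) = x v" "w (y v) = Var v" for c v
    using w(2) specializes_Const[OF homs(1)] specializes_Var[OF homs(1)] y by blast+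
  have w'_gen: "w' (Const c) = Const (\<theta>' c)" "w' (Var v) = y v" "w' (x v) = Var v" for c v
    using w'(2) specializes_Const[OF homs(2)] specializes_Var[OF homs(2)] x by blast+
  have "(\<lambda>f. w (w' f)) = (\<lambda>f. f)" "(\<lambda>f. w' (w f)) = (\<lambda>f. f)"
    by (rule field_hom_ratfun_eqI;
        simp add: field_hom_compose field_hom_id w(1) w'(1) w_gen w'_gen inv)+
  then have "bij w" by (metis bijI' )
  with w w_gen show thesis by (intro that)
qed

section \<open>Derivations of fields of rational functions\<close>

lemma pderivative_add:
  "pderivative v (f + g) = pderivative v f + pderivative v (g :: ('v::linorder, 'k::idom) ratfun)"
  by (cases f rule: Fract_cases; cases g rule: Fract_cases)
    (simp add: pderivative_Fract eq_fract mpol_deriv_add mpol_deriv_mult algebra_simps)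

lemma pderivative_mult:
  "pderivative v (f * g) = f * pderivative v g + pderivative v f * (g :: ('v::linorder, 'k::idom) ratfun)"
  by (cases f rule: Fract_cases; cases g rule: Fract_cases)
    (simp add: pderivative_Fract eq_fract mpol_deriv_mult algebra_simps)

text \<open>For \<open>w\<close> the identity these are ordinary derivations. The twist makes
  \<open>D (w f)\<close> and \<open>w (D f)\<close>, the two sides of an intertwining relation,
  derivations of the same kind.\<close>

definition derivation_along :: "('a::field \<Rightarrow> 'b::field) \<Rightarrow> ('a \<Rightarrow> 'b) \<Rightarrow> bool" where
  "derivation_along w D \<longleftrightarrow>
     (\<forall>x y. D (x + y) = D x + D y) \<and> (\<forall>x y. D (x * y) = w x * D y + D x * w y)"

lemma derivation_along_simps:
  assumes D: "derivation_along w D" and w: "field_hom w"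
  shows "D (x + y) = D x + D y" "D (x * y) = w x * D y + D x * w y" "D 0 = 0" "D 1 = 0"
    "D (- x) = - D x" "D (x - y) = D x - D y"
    "y \<noteq> 0 \<Longrightarrow> D (x / y) = (D x * w y - w x * D y) / (w y)\<^sup>2"
proof -
  note hom = field_hom_simps[OF w]
  show add: "\<And>x y. D (x + y) = D x + D y" and mult: "\<And>x y. D (x * y) = w x * D y + D x * w y"
    using D by (simp_all add: derivation_along_def)
  show 0: "D 0 = 0" using add[of 0 0] by (metis add_0 add_cancel_left_right)
  show "D 1 = 0" using mult[of 1 1] unfolding hom mult_1_left mult_1_right by (metis add_cancel_left_right)
  show minus: "D (- x) = - D x" for x using add[of x "- x"] 0 by (simp add: eq_neg_iff_add_eq_0 add.commute)
  show "D (x - y) = D x - D y" using add[of x "- y"] minus by simp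
  show "D (x / y) = (D x * w y - w x * D y) / (w y)\<^sup>2" if "y \<noteq> 0"
    using mult[of "x / y" y] that by (simp add: hom field_simps power2_eq_square)
qed

lemma derivation_along_eqI:
  fixes w :: "('v::linorder, 'k::field) ratfun \<Rightarrow> 'b::field"
  assumes "field_hom w" "derivation_along w D" "derivation_along w E"
    and "\<And>c. D (Const c) = E (Const c)" "\<And>v. D (Var v) = E (Var v)"
  shows "D f = E f"
  by (induction f rule: ratfun_induct)
    (simp_all add: assms(4,5) derivation_along_simps[OF assms(2,1)] derivation_along_simps[OF assms(3,1)])

lemma derivation_pderivative: "derivation_along (\<lambda>f. f) (pderivative v :: ('v::linorder, 'k::field) ratfun \<Rightarrow> _)"
  by (simp add: derivation_along_def pderivative_add pderivative_mult)

lemmas pderivative_simps = pderivative_Const pderivative_Var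
  derivation_along_simps[OF derivation_pderivative field_hom_id]

lemma numeral_eq_Const: "numeral n = (Const (numeral n) :: ('v::linorder, 'k::field) ratfun)"
  by (simp add: field_hom_simps[OF field_hom_Const])

lemma pderivative_numeral: "pderivative v (numeral n :: ('v::linorder, 'k::field) ratfun) = 0"
  by (metis numeral_eq_Const pderivative_Const)

lemma derivation_along_compose_right:
  "derivation_along (\<lambda>f. f) D \<Longrightarrow> field_hom w \<Longrightarrow> derivation_along w (\<lambda>f. D (w f))"
  by (simp add: derivation_along_def field_hom_def)

lemma derivation_along_compose_left:
  "derivation_along (\<lambda>f. f) D \<Longrightarrow> field_hom w \<Longrightarrow> derivation_along w (\<lambda>f. w (D f))"
  by (simp add: derivation_along_def field_hom_def)

section \<open>Canonical transformations and the Hamiltonian system\<close>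

lemma poisson_expand:
  "poisson f g = pderivative P1 f * pderivative Q1 g - pderivative Q1 f * pderivative P1 g
     + (pderivative P2 f * pderivative Q2 g - pderivative Q2 f * pderivative P2 g)
     + (pderivative P3 f * pderivative Q3 g - pderivative Q3 f * pderivative P3 g)"
proof -
  have "{1..3} = {1, 2, 3 :: nat}" by auto
  then show ?thesis by (simp add: poisson_def q_coord_def p_coord_def)
qed

lemma derivation_poisson_right: "derivation_along (\<lambda>f. f) (poisson f)"
  and derivation_poisson_left: "derivation_along (\<lambda>f. f) (\<lambda>f. poisson f g)"
  by (simp_all add: derivation_along_def poisson_expand pderivative_simps algebra_simps)

lemma poisson_Const [simp]: "poisson f (Const c) = 0" "poisson (Const c) f = 0"
  by (simp_all add: poisson_expand)

text \<open>By the chain rule the sum over the coordinates is the bracket with \<open>f\<close>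
  itself, a form to which canonicity applies directly.\<close>

lemma ddt_eq_poisson:
  "ddt \<alpha> f = pderivative Sv f + poisson (hamiltonian \<alpha>) f / (Var Sv * (Var Sv - 1))"
proof -
  have I: "{1..3} = {1, 2, 3 :: nat}" by auto
  show ?thesis
    unfolding ddt_def I
    by (simp add: poisson_expand[of _ f] poisson_expand[of _ "Var _"] pderivative_Var q_coord_def p_coord_def
        add_divide_distrib diff_divide_distrib)
qed

lemma sv_nonzero: "(sv :: 'k::field phase) \<noteq> 0" and sv_neq_1: "(sv :: 'k::field phase) \<noteq> 1"
proof -
  have "pderivative Sv (sv :: 'k phase) \<noteq> pderivative Sv 0" "pderivative Sv (sv :: 'k phase) \<noteq> pderivative Sv 1"
    by (simp_all add: pderivative_simps)
  then show "(sv :: 'k phase) \<noteq> 0" "(sv :: 'k phase) \<noteq> 1" by metis+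
qed

lemma derivation_ddt: "derivation_along (\<lambda>f. f) (ddt \<alpha>)"
  using derivation_poisson_right[of "hamiltonian \<alpha>"]
  by (simp add: derivation_along_def ddt_eq_poisson pderivative_simps add_divide_distrib algebra_simps)

lemma poisson_homI:
  assumes w: "field_hom w" "\<And>c. w (Const c) = Const (\<theta> c)"
    and gen: "\<And>u v. poisson (w (Var u)) (w (Var v)) = w (poisson (Var u) (Var v))"
  shows "w (poisson f g) = poisson (w f) (w g)"
proof -
  \<comment> \<open>With a coordinate fixed on the right, both sides are derivations along
    \<open>w\<close> in \<open>f\<close>. The second pass repeats the argument in
    \<open>g\<close>.\<close>
  have "w (poisson f (Var v)) = poisson (w f) (w (Var v))" for f v
    using w(1) derivation_along_compose_left[OF derivation_poisson_left w(1)]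
      derivation_along_compose_right[OF derivation_poisson_left w(1)]
    by (rule derivation_along_eqI) (simp_all add: gen w(2) field_hom_simps[OF w(1)])
  then show ?thesis
    by (intro derivation_along_eqI[OF w(1) derivation_along_compose_left[OF derivation_poisson_right w(1)]
      derivation_along_compose_right[OF derivation_poisson_right w(1)], where f = g])
      (simp_all add: w(2) field_hom_simps[OF w(1)])
qed

text \<open>
  For a time-dependent canonical transformation the two Hamiltonians differ by a function \<open>K\<close>
  that generates the explicit time dependence.
\<close>

lemma ddt_intertwined:
  assumes w: "field_hom w" "\<And>c. w (Const c) = Const (\<theta> c)" "w sv = sv"
    and can: "\<And>f g. w (poisson f g) = poisson (w f) (w g)"
    and ham: "w (hamiltonian \<alpha>') = hamiltonian \<alpha> + K"
    and K: "\<And>v. poisson K (w (Var v)) =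
      sv * (sv - 1) * (pderivative Sv (w (Var v)) - w (pderivative Sv (Var v)))"
  shows "w (ddt \<alpha>' f) = ddt \<alpha> (w f)"
proof (rule derivation_along_eqI[OF w(1)
      derivation_along_compose_left[OF derivation_ddt w(1)] derivation_along_compose_right[OF derivation_ddt w(1)]])
  note hom = field_hom_simps[OF w(1)]
  show "w (ddt \<alpha>' (Const c)) = ddt \<alpha> (w (Const c))" for c
    by (simp add: ddt_eq_poisson w hom)
  show "w (ddt \<alpha>' (Var v)) = ddt \<alpha> (w (Var v))" for v
  proof -
    \<comment> \<open>After division by \<open>sv * (sv - 1)\<close> the bracket with
      \<open>K\<close> replaces \<open>w (pderivative Sv (Var v))\<close> by
      \<open>pderivative Sv (w (Var v))\<close>.\<close>
    have "poisson (hamiltonian \<alpha> + K) (w (Var v)) =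
        poisson (hamiltonian \<alpha>) (w (Var v)) + poisson K (w (Var v))"
      by (rule derivation_along_simps(1)[OF derivation_poisson_left field_hom_id])
    then show ?thesis
      by (simp add: ddt_eq_poisson hom w can ham K sv_nonzero sv_neq_1 add_divide_distrib)
  qed
qed

section \<open>The Hamiltonian and its transformation laws\<close>

text \<open>
  Here \<open>c\<close> is \<open>\<alpha> 3\<close>, and for the pair \<open>(q, p)\<close> with index \<open>i\<close> the parameters \<open>a\<close> and \<open>b\<close> are
  those of the middle node \<open>2 * i\<close> and of the outer node of the \<open>i\<close>-th leg of the diagram.
\<close>

definition coupled_part :: "'a \<Rightarrow> 'a \<Rightarrow> 'a \<Rightarrow> 'a \<Rightarrow> 'a \<Rightarrow> 'a \<Rightarrow> 'a::comm_ring_1" where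
  "coupled_part s c q p a b =
     q * (q - 1) * (q - s) * p^2
     - (b * q * (q - s) + c * (q - 1) * (q - s) - (b + 2 * a + 2 * c) * q * (q - 1)) * p
     + a * (c + a) * q"

definition coupling :: "'a \<Rightarrow> 'a \<Rightarrow> 'a \<Rightarrow> 'a \<Rightarrow> 'a \<Rightarrow> 'a \<Rightarrow> 'a \<Rightarrow> 'a::comm_ring_1" where
  "coupling s q p a q' p' a' = ((q - 1) * p + a) * ((q' - 1) * p' + a') * (q * q' + s)"

text \<open>Arguments are grouped by leg, so that a permutation of the legs is a permutation of
  arguments. Over a commutative ring the identities below contain no division.\<close>

definition coupled ::
    "'a \<Rightarrow> 'a \<Rightarrow> 'a \<Rightarrow> 'a \<Rightarrow> 'a \<Rightarrow> 'a \<Rightarrow> 'a \<Rightarrow> 'a \<Rightarrow> 'a \<Rightarrow> 'a \<Rightarrow> 'a \<Rightarrow> 'a \<Rightarrow> 'a \<Rightarrow> 'a \<Rightarrow> 'a::comm_ring_1" where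
  "coupled s c q1 p1 a1 b1 q2 p2 a2 b2 q3 p3 a3 b3 =
     coupled_part s c q1 p1 a1 b1 + coupled_part s c q2 p2 a2 b2 + coupled_part s c q3 p3 a3 b3
     + coupling s q1 p1 a1 q2 p2 a2 + coupling s q1 p1 a1 q3 p3 a3 + coupling s q2 p2 a2 q3 p3 a3"

lemma coupled_swap:
  "coupled s c q1 p1 a1 b1 q2 p2 a2 b2 q3 p3 a3 b3 = coupled s c q2 p2 a2 b2 q1 p1 a1 b1 q3 p3 a3 b3"
  "coupled s c q1 p1 a1 b1 q2 p2 a2 b2 q3 p3 a3 b3 = coupled s c q3 p3 a3 b3 q2 p2 a2 b2 q1 p1 a1 b1"
  by (simp_all add: coupled_def coupling_def mult_ac add_ac)

text \<open>
  Writing the parameter of a reflection as \<open>u\<close> times its \<open>\<phi>\<close> turns its action on the Hamiltonian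
  into a polynomial identity.
\<close>

lemma coupled_outer:
  shows "b1 = u * (q1 - 1) \<Longrightarrow>
    coupled s c q1 (p1 - u) (a1 + b1) (- b1) q2 p2 a2 b2 q3 p3 a3 b3 =
    coupled s c q1 p1 a1 b1 q2 p2 a2 b2 q3 p3 a3 b3 - s * b1 * c" (is "_ \<Longrightarrow> ?goal")
    and "b2 = u * (q2 - 1) \<Longrightarrow>
    coupled s c q1 p1 a1 b1 q2 (p2 - u) (a2 + b2) (- b2) q3 p3 a3 b3 =
    coupled s c q1 p1 a1 b1 q2 p2 a2 b2 q3 p3 a3 b3 - s * b2 * c"
    and "b3 = u * (q3 - 1) \<Longrightarrow>
    coupled s c q1 p1 a1 b1 q2 p2 a2 b2 q3 (p3 - u) (a3 + b3) (- b3) =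
    coupled s c q1 p1 a1 b1 q2 p2 a2 b2 q3 p3 a3 b3 - s * b3 * c"
proof -
  \<comment> \<open>Only the first leg is computed; exchanging legs by \<open>coupled_swap\<close>
    yields the other two.\<close>
  have *: "coupled s c q1 (p1 - u) (a1 + b1) (- b1) q2 p2 a2 b2 q3 p3 a3 b3 =
      coupled s c q1 p1 a1 b1 q2 p2 a2 b2 q3 p3 a3 b3 - s * b1 * c"
    if "b1 = u * (q1 - 1)" for q1 p1 a1 b1 q2 p2 a2 b2 q3 p3 a3 b3 :: 'a
    unfolding that coupled_def coupling_def coupled_part_def
    by (simp add: algebra_simps power2_eq_square)
  show "b1 = u * (q1 - 1) \<Longrightarrow> ?goal" by (rule *)
  show "coupled s c q1 p1 a1 b1 q2 (p2 - u) (a2 + b2) (- b2) q3 p3 a3 b3 =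
      coupled s c q1 p1 a1 b1 q2 p2 a2 b2 q3 p3 a3 b3 - s * b2 * c" if "b2 = u * (q2 - 1)"
    unfolding coupled_swap(1)[of s c q1 p1] using that by (rule *)
  show "coupled s c q1 p1 a1 b1 q2 p2 a2 b2 q3 (p3 - u) (a3 + b3) (- b3) =
      coupled s c q1 p1 a1 b1 q2 p2 a2 b2 q3 p3 a3 b3 - s * b3 * c" if "b3 = u * (q3 - 1)"
    unfolding coupled_swap(2)[of s c q1 p1] using that by (rule *)
qed

text \<open>Here \<open>u\<close> is the shift of \<open>q\<close> at a middle node, whose parameter
  is added to those of its neighbours, the centre and the outer node. The correction involves only
  \<open>s\<close> and the parameters.\<close>

lemma coupled_middle:
  shows "a1 = u * p1 \<Longrightarrow>
    coupled s (c + a1) (q1 + u) p1 (- a1) (b1 + a1) q2 p2 a2 b2 q3 p3 a3 b3 =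
    coupled s c q1 p1 a1 b1 q2 p2 a2 b2 q3 p3 a3 b3
      + a1 * ((s - 1) * (b1 + a1 + c) - s * (a2 + a3))" (is "_ \<Longrightarrow> ?goal")
    and "a2 = u * p2 \<Longrightarrow>
    coupled s (c + a2) q1 p1 a1 b1 (q2 + u) p2 (- a2) (b2 + a2) q3 p3 a3 b3 =
    coupled s c q1 p1 a1 b1 q2 p2 a2 b2 q3 p3 a3 b3
      + a2 * ((s - 1) * (b2 + a2 + c) - s * (a1 + a3))"
    and "a3 = u * p3 \<Longrightarrow>
    coupled s (c + a3) q1 p1 a1 b1 q2 p2 a2 b2 (q3 + u) p3 (- a3) (b3 + a3) =
    coupled s c q1 p1 a1 b1 q2 p2 a2 b2 q3 p3 a3 b3
      + a3 * ((s - 1) * (b3 + a3 + c) - s * (a2 + a1))"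
proof -
  have *: "coupled s (c + a1) (q1 + u) p1 (- a1) (b1 + a1) q2 p2 a2 b2 q3 p3 a3 b3 =
      coupled s c q1 p1 a1 b1 q2 p2 a2 b2 q3 p3 a3 b3
      + a1 * ((s - 1) * (b1 + a1 + c) - s * (a2 + a3))"
    if "a1 = u * p1" for q1 p1 a1 b1 q2 p2 a2 b2 q3 p3 a3 b3 :: 'a
    unfolding that coupled_def coupling_def coupled_part_def
    by (simp add: algebra_simps power2_eq_square)
  show "a1 = u * p1 \<Longrightarrow> ?goal" by (rule *)
  show "coupled s (c + a2) q1 p1 a1 b1 (q2 + u) p2 (- a2) (b2 + a2) q3 p3 a3 b3 =
      coupled s c q1 p1 a1 b1 q2 p2 a2 b2 q3 p3 a3 b3
      + a2 * ((s - 1) * (b2 + a2 + c) - s * (a1 + a3))" if "a2 = u * p2"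
    unfolding coupled_swap(1)[of s _ q1 p1] using that by (rule *)
  show "coupled s (c + a3) q1 p1 a1 b1 q2 p2 a2 b2 (q3 + u) p3 (- a3) (b3 + a3) =
      coupled s c q1 p1 a1 b1 q2 p2 a2 b2 q3 p3 a3 b3
      + a3 * ((s - 1) * (b3 + a3 + c) - s * (a2 + a1))" if "a3 = u * p3"
    unfolding coupled_swap(2)[of s _ q1 p1] using that by (rule *)
qed

text \<open>The momenta are shifted by \<open>u\<close> times the gradient of
  \<open>q1 * q2 * q3\<close>. The sum multiplying \<open>u * s * (s - 1)\<close> is the left side
  of the linear relation between the parameters; the other correction involves only \<open>s\<close>
  and the parameters.\<close>

lemma coupled_centre:
  assumes "c = u * (q1 * q2 * q3 - s)"
  shows "coupled s (- c) q1 (p1 - u * (q2 * q3)) (a1 + c) b1 q2 (p2 - u * (q1 * q3)) (a2 + c) b2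
      q3 (p3 - u * (q1 * q2)) (a3 + c) b3 =
    coupled s c q1 p1 a1 b1 q2 p2 a2 b2 q3 p3 a3 b3
      - u * s * (s - 1) * (b3 + b1 + 2 * a1 + 3 * c + 2 * a2 + b2 + 2 * a3)
      + c * (3 * c + 2 * (a1 + a2 + a3) + (1 - s) * (b1 + b2 + b3))"
  unfolding assms coupled_def coupling_def coupled_part_def by (simp add: algebra_simps power2_eq_square)

text \<open>In each summand, halving in the relation for the \<beta>'s gives \<beta>2 as the
  parameter of the middle node.\<close>

lemma hamiltonian_eq_coupled:
  assumes "(2::'k::field) \<noteq> 0"
  shows "hamiltonian (\<alpha> :: nat \<Rightarrow> 'k) =
    coupled (Var Sv) (Const (\<alpha> 3)) (Var Q1) (Var P1) (Const (\<alpha> 2)) (Const (\<alpha> 1))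
      (Var Q2) (Var P2) (Const (\<alpha> 4)) (Const (\<alpha> 5)) (Var Q3) (Var P3) (Const (\<alpha> 6)) (Const (\<alpha> 0))"
proof -
  have two: "(2 :: 'k phase) \<noteq> 0"
    using assms field_hom_simps(12)[OF field_hom_Const, of "2::'k"] numeral_eq_Const[of "num.Bit0 num.One"]
    by metis
  \<comment> \<open>The three versions differ in the order in which the legs write the terms of
    \<beta>1.\<close>
  have HVI: "H_VI p q s c (1 - b - 2 * a - 2 * c) b c = coupled_part s c q p a b"
    "H_VI p q s c (1 - 2 * c - 2 * a - b) b c = coupled_part s c q p a b"
    "H_VI p q s c (1 - b - 2 * c - 2 * a) b c = coupled_part s c q p a b"
    for p q s a b c :: "'k phase"
  proof -
    have "(1 - c - (1 - b - 2 * a - 2 * c) - b - c) / 2 = a" "(1 - c - (1 - 2 * c - 2 * a - b) - b - c) / 2 = a"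
      "(1 - c - (1 - b - 2 * c - 2 * a) - b - c) / 2 = a"
      using two by (simp_all add: field_simps)
    then show "H_VI p q s c (1 - b - 2 * a - 2 * c) b c = coupled_part s c q p a b"
      "H_VI p q s c (1 - 2 * c - 2 * a - b) b c = coupled_part s c q p a b"
      "H_VI p q s c (1 - b - 2 * c - 2 * a) b c = coupled_part s c q p a b"
      unfolding H_VI_def coupled_part_def Let_def by (simp_all add: algebra_simps power2_eq_square)
  qed
  have pairs: "{(i, j). 1 \<le> i \<and> i < j \<and> j \<le> 3} = {(1, 2), (1, 3), (2, 3 :: nat)}" by auto
  show ?thesis
    unfolding hamiltonian_def Let_def HVI pairs
    by (simp add: q_coord_def p_coord_def coupled_def coupling_def)
qed

lemma field_hom_coupled:
  assumes "field_hom w"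
  shows "w (coupled s c q1 p1 a1 b1 q2 p2 a2 b2 q3 p3 a3 b3) =
    coupled (w s) (w c) (w q1) (w p1) (w a1) (w b1) (w q2) (w p2) (w a2) (w b2)
      (w q3) (w p3) (w a3) (w b3)"
  by (simp add: coupled_def coupled_part_def coupling_def field_hom_simps[OF assms])

section \<open>Reflections and diagram automorphisms\<close>

lemma phi_simps:
  "\<phi> 0 = Var Q3 - 1" "\<phi> 1 = Var Q1 - 1" "\<phi> (Suc 0) = Var Q1 - 1" "\<phi> 2 = Var P1" "\<phi> 3 = Var Q1 * Var Q2 * Var Q3 - Var Sv"
  "\<phi> 4 = Var P2" "\<phi> 5 = Var Q2 - 1" "\<phi> 6 = Var P3"
  by (simp_all add: \<phi>_def q_coord_def p_coord_def)

lemma all_le_6: "(\<forall>j\<le>6::nat. P j) \<longleftrightarrow> P 0 \<and> P 1 \<and> P 2 \<and> P 3 \<and> P 4 \<and> P 5 \<and> P 6"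
proof -
  have "{..6::nat} = {0, 1, 2, 3, 4, 5, 6}" by auto
  then show ?thesis by (metis (no_types, lifting) atMost_iff insert_iff empty_iff)
qed

lemma all_coord: "(\<forall>v. P v) \<longleftrightarrow> P Q1 \<and> P Q2 \<and> P Q3 \<and> P P1 \<and> P P2 \<and> P P3 \<and> P Sv"
  by (metis coord.exhaust)

lemma le_6_cases:
  assumes "(i::nat) \<le> 6"
  obtains "i = 0" | "i = 1" | "i = 2" | "i = 3" | "i = 4" | "i = 5" | "i = 6"
  using assms by linarith

text \<open>Each \<open>\<phi> i\<close> has a nonzero partial derivative.\<close>

lemma phi_nonzero: "i \<le> 6 \<Longrightarrow> \<phi> i \<noteq> (0 :: 'k::field phase)"
proof -
  have "pderivative Q3 (\<phi> 0 :: 'k phase) \<noteq> 0" "pderivative Q1 (\<phi> 1 :: 'k phase) \<noteq> 0"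
    "pderivative P1 (\<phi> 2 :: 'k phase) \<noteq> 0" "pderivative Sv (\<phi> 3 :: 'k phase) \<noteq> 0"
    "pderivative P2 (\<phi> 4 :: 'k phase) \<noteq> 0" "pderivative Q2 (\<phi> 5 :: 'k phase) \<noteq> 0"
    "pderivative P3 (\<phi> 6 :: 'k phase) \<noteq> 0"
    by (simp_all add: phi_simps pderivative_simps)
  then show "i \<le> 6 \<Longrightarrow> \<phi> i \<noteq> (0 :: 'k phase)"
    by (elim le_6_cases) (metis derivation_along_simps(3)[OF derivation_pderivative field_hom_id])+
qed

section \<open>Reflections as substitutions of the coordinates\<close>

definition shift :: "nat \<Rightarrow> 'k::field \<Rightarrow> coord \<Rightarrow> 'k phase" where
  "shift i c v = Var v + Const c / \<phi> i * poisson (\<phi> i) (Var v)"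

lemma shift_simps:
  "shift 0 c v = (if v = P3 then Var P3 - Const c / (Var Q3 - 1) else Var v)"
  "shift 1 c v = (if v = P1 then Var P1 - Const c / (Var Q1 - 1) else Var v)"
  "shift 2 c v = (if v = Q1 then Var Q1 + Const c / Var P1 else Var v)"
  "shift 3 c v = (case v of
       P1 \<Rightarrow> Var P1 - Const c / (Var Q1 * Var Q2 * Var Q3 - Var Sv) * (Var Q2 * Var Q3)
     | P2 \<Rightarrow> Var P2 - Const c / (Var Q1 * Var Q2 * Var Q3 - Var Sv) * (Var Q1 * Var Q3)
     | P3 \<Rightarrow> Var P3 - Const c / (Var Q1 * Var Q2 * Var Q3 - Var Sv) * (Var Q1 * Var Q2)
     | _ \<Rightarrow> Var v)"
  "shift 4 c v = (if v = Q2 then Var Q2 + Const c / Var P2 else Var v)"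
  "shift 5 c v = (if v = P2 then Var P2 - Const c / (Var Q2 - 1) else Var v)"
  "shift 6 c v = (if v = Q3 then Var Q3 + Const c / Var P3 else Var v)"
  by (cases v; simp add: shift_def phi_simps poisson_expand pderivative_simps)+

lemmas shift_simps' = shift_simps shift_simps(2)[unfolded One_nat_def]

text \<open>The \<open>\<phi> j\<close> with \<open>j \<noteq> 3\<close> are the coordinates other
  than \<open>s\<close> up to additive constants, so their images together with that of
  \<open>s\<close> determine \<open>w\<close>. The formula for \<open>\<phi> 3\<close> then
  follows.\<close>

lemma r_phi_iff_shift:
  fixes w :: "'k::field phase \<Rightarrow> 'k phase"
  assumes w: "field_hom w" and i: "i \<le> 6"
  shows "w sv = sv \<and> (\<forall>j\<le>6. w (\<phi> j) = r_phi i \<alpha> j) \<longleftrightarrow> (\<forall>v. w (Var v) = shift i (\<alpha> i) v)"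
proof -
  show ?thesis using i phi_nonzero[OF i, where 'k = 'k]
    by (elim le_6_cases)
      (simp_all add: all_coord all_le_6 phi_simps shift_simps' r_phi_def field_hom_simps[OF w]
        poisson_expand pderivative_simps, auto simp: algebra_simps)
qed

text \<open>Formally the shift is the time-one flow of \<open>c * log (\<phi> i)\<close>; its
  second-order terms vanish because \<open>\<phi> i\<close> commutes with its brackets with
  coordinates. The proof checks all pairs of coordinates.\<close>

lemma poisson_shift:
  assumes "i \<le> 6"
  shows "poisson (shift i c u) (shift i c v) = poisson (Var u) (Var v)"
  using assms phi_nonzero[OF assms, where 'k = 'a]
  by (elim le_6_cases; cases u; cases v;
      simp add: phi_simps shift_simps' poisson_expand pderivative_simps)

text \<open>This is the inversion of a reflection: the substitution fixes the factors of the
  correction other than its constant, so the corrections by \<open>\<theta> c\<close> and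
  \<open>c'\<close> cancel. The constant in \<open>shift\<close> is arbitrary so that the inverse is
  again a shift.\<close>

lemma specializes_shift:
  fixes \<theta> :: "'k::field \<Rightarrow> 'k"
  assumes "field_hom \<theta>" "i \<le> 6" "\<theta> c = - c'"
  shows "specializes (\<lambda>c. Const (\<theta> c)) (shift i c') (shift i c v) (Var v)"
proof -
  have hom: "field_hom (\<lambda>c. Const (\<theta> c) :: 'k phase)"
    by (rule field_hom_compose[OF field_hom_Const assms(1)])
  note intros = specializes_intros[OF hom]
  let ?S = "specializes (\<lambda>c. Const (\<theta> c)) (shift i c')"
  \<comment> \<open>Coordinates commuting with \<open>\<phi> i\<close> are not moved, and
    \<open>\<phi> i\<close> and its brackets with coordinates are polynomials in these
    alone.\<close>
  have fixed: "?S (Var u) (Var u)" if "poisson (\<phi> i) (Var u :: 'k phase) = 0" for u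
    using specializes_Var[OF hom, of "shift i c'" u] that by (simp add: shift_def)
  have phi: "?S (\<phi> i) (\<phi> i)"
    using \<open>i \<le> 6\<close> fixed
    by (elim le_6_cases) (auto simp: phi_simps poisson_expand pderivative_simps intro!: intros)
  have "?S (poisson (\<phi> i) (Var v)) (poisson (\<phi> i) (Var v))"
    using \<open>i \<le> 6\<close> fixed
    by (elim le_6_cases; cases v) (auto simp: phi_simps poisson_expand pderivative_simps intro!: intros)
  then have "?S (shift i c v) (shift i c' v + Const (\<theta> c) / \<phi> i * poisson (\<phi> i) (Var v))"
    unfolding shift_def[of i c] by (intro intros phi phi_nonzero \<open>i \<le> 6\<close>)
  moreover have "shift i c' v + Const (\<theta> c) / \<phi> i * poisson (\<phi> i) (Var v) = Var v"
    by (simp add: shift_def assms(3) field_hom_simps[OF field_hom_Const])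
  ultimately show ?thesis by simp
qed

lemma hamiltonian_shift:
  fixes w :: "'k::field phase \<Rightarrow> 'k phase"
  assumes two: "(2::'k) \<noteq> 0" and rel: "param_relation \<alpha>" and i: "i \<le> 6"
    and w: "field_hom w" "\<And>v. w (Var v) = shift i (\<alpha> i) v"
    and par: "\<And>j. j \<le> 6 \<Longrightarrow> w (Const (\<alpha>' j)) = Const (r_param i \<alpha> j)"
  shows "\<exists>K. w (hamiltonian \<alpha>') = hamiltonian \<alpha> + K \<and>
    (\<forall>v. poisson K (w (Var v)) = sv * (sv - 1) * (pderivative Sv (w (Var v)) - w (pderivative Sv (Var v))))"
proof -
  note C = field_hom_simps[OF field_hom_Const]
  let ?c = "\<lambda>j. Const (\<alpha> j) :: 'k phase"
  have ham: "w (hamiltonian \<alpha>') =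
      coupled (shift i (\<alpha> i) Sv) (Const (r_param i \<alpha> 3))
       (shift i (\<alpha> i) Q1) (shift i (\<alpha> i) P1) (Const (r_param i \<alpha> 2)) (Const (r_param i \<alpha> 1))
       (shift i (\<alpha> i) Q2) (shift i (\<alpha> i) P2) (Const (r_param i \<alpha> 4)) (Const (r_param i \<alpha> 5))
       (shift i (\<alpha> i) Q3) (shift i (\<alpha> i) P3) (Const (r_param i \<alpha> 6)) (Const (r_param i \<alpha> 0))"
    by (simp add: hamiltonian_eq_coupled[OF two] field_hom_coupled[OF w(1)] w(2) par)
  note simps = r_param_def cartan_def C shift_simps' hamiltonian_eq_coupled[OF two]
  note derivs = poisson_expand pderivative_simps pderivative_numeral field_hom_simps[OF w(1)] w(2)
  show ?thesis
    using i
  proof (cases rule: le_6_cases)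
    \<comment> \<open>Case \<open>n\<close> treats the node \<open>n - 1\<close>. Except at node 3
      the shifts do not involve \<open>s\<close> explicitly and \<open>K\<close> depends on
      \<open>s\<close> alone, so both sides of the condition on \<open>K\<close> vanish.\<close>
    case 1
    have "w (hamiltonian \<alpha>') = hamiltonian \<alpha> + - (sv * ?c 0 * ?c 3)"
      unfolding ham 1 using phi_nonzero[of 0, where 'k = 'k]
      by (simp add: simps phi_simps coupled_outer(3))
    moreover have "poisson (- (sv * ?c 0 * ?c 3)) (w (Var v)) =
        sv * (sv - 1) * (pderivative Sv (w (Var v)) - w (pderivative Sv (Var v)))" for v
      unfolding w 1 using phi_nonzero[of 0, where 'k = 'k]
      by (simp add: derivs shift_simps' phi_simps)
    ultimately show ?thesis by blast
  next
    case 2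
    have "w (hamiltonian \<alpha>') = hamiltonian \<alpha> + - (sv * ?c 1 * ?c 3)"
      unfolding ham 2 using phi_nonzero[of 1, where 'k = 'k]
      by (simp add: simps phi_simps coupled_outer(1))
    moreover have "poisson (- (sv * ?c 1 * ?c 3)) (w (Var v)) =
        sv * (sv - 1) * (pderivative Sv (w (Var v)) - w (pderivative Sv (Var v)))" for v
      unfolding w 2 using phi_nonzero[of 1, where 'k = 'k]
      by (simp add: derivs shift_simps' phi_simps)
    ultimately show ?thesis by blast
  next
    case 3
    let ?K = "?c 2 * ((sv - 1) * (?c 1 + ?c 2 + ?c 3) - sv * (?c 4 + ?c 6))"
    have "w (hamiltonian \<alpha>') = hamiltonian \<alpha> + ?K"
      unfolding ham 3 using phi_nonzero[of 2, where 'k = 'k]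
      by (simp add: simps phi_simps coupled_middle(1))
    moreover have "poisson ?K (w (Var v)) =
        sv * (sv - 1) * (pderivative Sv (w (Var v)) - w (pderivative Sv (Var v)))" for v
      unfolding w 3 using phi_nonzero[of 2, where 'k = 'k]
      by (simp add: derivs shift_simps' phi_simps)
    ultimately show ?thesis by blast
  next
    case 4
    let ?f = "Var Q1 * Var Q2 * Var Q3 - Var Sv :: 'k phase"
    \<comment> \<open>This part depends on \<open>s\<close> alone and has zero brackets; the rest of
      \<open>?K\<close> generates the explicit time dependence.\<close>
    let ?k = "?c 3 * (3 * ?c 3 + 2 * (?c 2 + ?c 4 + ?c 6) + (1 - sv) * (?c 1 + ?c 5 + ?c 0))"
    let ?K = "?k - ?c 3 / ?f * sv * (sv - 1)"
    have f: "?f \<noteq> 0" using phi_nonzero[of 3, where 'k = 'k] by (simp add: phi_simps)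
    \<comment> \<open>The normalization of the parameters reduces the factor found in
      \<open>coupled_centre\<close> to 1.\<close>
    have "Const (\<alpha> 0 + \<alpha> 1 + 2 * \<alpha> 2 + 3 * \<alpha> 3 + 2 * \<alpha> 4 + \<alpha> 5 + 2 * \<alpha> 6) = (Const 1 :: 'k phase)"
      using rel by (simp add: param_relation_def)
    then have rel': "?c 0 + ?c 1 + 2 * ?c 2 + 3 * ?c 3 + 2 * ?c 4 + ?c 5 + 2 * ?c 6 = 1"
      by (simp add: C)
    have par: "Const (r_param 3 \<alpha> 0) = ?c 0" "Const (r_param 3 \<alpha> 1) = ?c 1" "Const (r_param 3 \<alpha> 2) = ?c 2 + ?c 3"
      "Const (r_param 3 \<alpha> 3) = - ?c 3" "Const (r_param 3 \<alpha> 4) = ?c 4 + ?c 3" "Const (r_param 3 \<alpha> 5) = ?c 5"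
      "Const (r_param 3 \<alpha> 6) = ?c 6 + ?c 3"
      by (simp_all add: simps)
    have "?c 3 = ?c 3 / ?f * ?f" using f by simp
    from coupled_centre[OF this, of "Var P1" "?c 2" "?c 1" "Var P2" "?c 4" "?c 5" "Var P3" "?c 6" "?c 0"]
    have "w (hamiltonian \<alpha>') = hamiltonian \<alpha>
        - ?c 3 / ?f * sv * (sv - 1) * (?c 0 + ?c 1 + 2 * ?c 2 + 3 * ?c 3 + 2 * ?c 4 + ?c 5 + 2 * ?c 6) + ?k"
      unfolding ham 4 par shift_simps coord.case hamiltonian_eq_coupled[OF two, of \<alpha>] .
    then have "w (hamiltonian \<alpha>') = hamiltonian \<alpha> + ?K"
      unfolding rel' by (simp del: times_divide_eq_left times_divide_eq_right)
    \<comment> \<open>For the momenta both sides come from differentiating \<open>1 / ?f\<close>: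
      the derivative of \<open>?f\<close> by \<open>s\<close> is -1, and its derivative by a
      position is the product occurring in the shift of the conjugate momentum.\<close>
    moreover have "poisson ?K (w (Var v)) =
        sv * (sv - 1) * (pderivative Sv (w (Var v)) - w (pderivative Sv (Var v)))" for v
      unfolding w 4 using f by (cases v; simp add: derivs shift_simps')
    ultimately show ?thesis by blast
  next
    case 5
    let ?K = "?c 4 * ((sv - 1) * (?c 5 + ?c 4 + ?c 3) - sv * (?c 2 + ?c 6))"
    have "w (hamiltonian \<alpha>') = hamiltonian \<alpha> + ?K"
      unfolding ham 5 using phi_nonzero[of 4, where 'k = 'k]
      by (simp add: simps phi_simps coupled_middle(2))
    moreover have "poisson ?K (w (Var v)) =
        sv * (sv - 1) * (pderivative Sv (w (Var v)) - w (pderivative Sv (Var v)))" for v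
      unfolding w 5 using phi_nonzero[of 4, where 'k = 'k]
      by (simp add: derivs shift_simps' phi_simps)
    ultimately show ?thesis by blast
  next
    case 6
    have "w (hamiltonian \<alpha>') = hamiltonian \<alpha> + - (sv * ?c 5 * ?c 3)"
      unfolding ham 6 using phi_nonzero[of 5, where 'k = 'k]
      by (simp add: simps phi_simps coupled_outer(2))
    moreover have "poisson (- (sv * ?c 5 * ?c 3)) (w (Var v)) =
        sv * (sv - 1) * (pderivative Sv (w (Var v)) - w (pderivative Sv (Var v)))" for v
      unfolding w 6 using phi_nonzero[of 5, where 'k = 'k]
      by (simp add: derivs shift_simps' phi_simps)
    ultimately show ?thesis by blast
  next
    case 7
    let ?K = "?c 6 * ((sv - 1) * (?c 0 + ?c 6 + ?c 3) - sv * (?c 4 + ?c 2))"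
    have "w (hamiltonian \<alpha>') = hamiltonian \<alpha> + ?K"
      unfolding ham 7 using phi_nonzero[of 6, where 'k = 'k]
      by (simp add: simps phi_simps coupled_middle(3))
    moreover have "poisson ?K (w (Var v)) =
        sv * (sv - 1) * (pderivative Sv (w (Var v)) - w (pderivative Sv (Var v)))" for v
      unfolding w 7 using phi_nonzero[of 6, where 'k = 'k]
      by (simp add: derivs shift_simps' phi_simps)
    ultimately show ?thesis by blast
  qed
qed

theorem shift_automorphism:
  fixes \<theta> \<theta>' :: "'k::field \<Rightarrow> 'k"
  assumes two: "(2::'k) \<noteq> 0" and rel: "param_relation \<alpha>" and i: "i \<le> 6"
    and \<theta>: "field_hom \<theta>" "field_hom \<theta>'" "\<And>c. \<theta>' (\<theta> c) = c" "\<And>c. \<theta> (\<theta>' c) = c"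
    and par: "\<And>j. j \<le> 6 \<Longrightarrow> \<theta> (\<alpha>' j) = r_param i \<alpha> j"
  obtains w where "field_hom w" "\<And>c. w (Const c) = Const (\<theta> c)" "\<And>v. w (Var v) = shift i (\<alpha> i) v"
    "birational_canonical w" "\<And>f. w (ddt \<alpha>' f) = ddt \<alpha> (w f)"
proof -
  \<comment> \<open>The diagonal entry 2 of the Cartan matrix produces the sign that the inverse
    shift requires.\<close>
  have neg: "\<theta> (\<alpha>' i) = - \<alpha> i"
    using par[OF i] i by (elim le_6_cases) (simp_all add: r_param_def cartan_def)
  then have neg': "\<theta>' (\<alpha> i) = - \<alpha>' i"
    using \<theta>(3)[of "\<alpha>' i"] by (simp add: field_hom_simps[OF \<theta>(2)] minus_equation_iff)
  obtain w where w: "field_hom w" "bij w" "\<And>c. w (Const c) = Const (\<theta> c)" "\<And>v. w (Var v) = shift i (\<alpha> i) v"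
    using ratfun_automorphism[OF \<theta>, of "shift i (\<alpha>' i)" "shift i (\<alpha> i)"]
      specializes_shift[OF \<theta>(2) i neg'] specializes_shift[OF \<theta>(1) i neg] by blast
  have sv: "w sv = sv" using i by (elim le_6_cases) (simp_all add: w shift_simps')
  have can: "w (poisson f g) = poisson (w f) (w g)" for f g
  proof (rule poisson_homI[OF w(1,3)])
    show "poisson (w (Var u)) (w (Var v)) = w (poisson (Var u) (Var v))" for u v
      unfolding w(4) poisson_shift[OF i]
      by (cases u; cases v; simp add: poisson_expand pderivative_simps field_hom_simps[OF w(1)])
  qed
  obtain K where K: "w (hamiltonian \<alpha>') = hamiltonian \<alpha> + K"
    "\<And>v. poisson K (w (Var v)) = sv * (sv - 1) * (pderivative Sv (w (Var v)) - w (pderivative Sv (Var v)))"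
    using hamiltonian_shift[OF two rel i w(1,4), of \<alpha>'] par by (auto simp: w(3))
  show thesis
    using that[OF w(1,3,4)] w(2) can ddt_intertwined[OF w(1,3) sv can K]
    by (simp add: birational_canonical_def)
qed

section \<open>Diagram automorphisms as permutations of the canonical pairs\<close>

definition perm1 :: "coord \<Rightarrow> coord" where "perm1 = transpose Q1 Q3 \<circ> transpose P1 P3"
definition perm2 :: "coord \<Rightarrow> coord" where "perm2 = transpose Q2 Q3 \<circ> transpose P2 P3"

lemma perm_simps:
  "perm1 Q1 = Q3" "perm1 Q2 = Q2" "perm1 Q3 = Q1" "perm1 P1 = P3" "perm1 P2 = P2" "perm1 P3 = P1" "perm1 Sv = Sv"
  "perm2 Q1 = Q1" "perm2 Q2 = Q3" "perm2 Q3 = Q2" "perm2 P1 = P1" "perm2 P2 = P3" "perm2 P3 = P2" "perm2 Sv = Sv"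
  by (simp_all add: perm1_def perm2_def transpose_def)

lemma sigma_simps:
  "\<sigma>1 0 = 1" "\<sigma>1 1 = 0" "\<sigma>1 (Suc 0) = 0" "\<sigma>1 2 = 6" "\<sigma>1 3 = 3" "\<sigma>1 4 = 4" "\<sigma>1 5 = 5" "\<sigma>1 6 = 2"
  "\<sigma>2 0 = 5" "\<sigma>2 1 = 1" "\<sigma>2 (Suc 0) = Suc 0" "\<sigma>2 2 = 2" "\<sigma>2 3 = 3" "\<sigma>2 4 = 6" "\<sigma>2 5 = 0" "\<sigma>2 6 = 4"
  by (simp_all add: \<sigma>1_def \<sigma>2_def transpose_def)

text \<open>\<open>\<sigma>1\<close> exchanges the first and third legs of the diagram,
  \<open>\<sigma>2\<close> the second and third; \<open>perm1\<close> and \<open>perm2\<close>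
  exchange the corresponding canonical pairs. \<open>\<phi> 3\<close> is symmetric in the
  legs.\<close>

lemma phi_sigma_iff_perm:
  fixes w :: "'k::field phase \<Rightarrow> 'k phase"
  assumes w: "field_hom w" and perm: "(\<sigma>, \<tau>) \<in> {(\<sigma>1, perm1), (\<sigma>2, perm2)}"
  shows "w sv = sv \<and> (\<forall>j\<le>6. w (\<phi> j) = (\<phi> \<circ> \<sigma>) j) \<longleftrightarrow> (\<forall>v. w (Var v) = Var (\<tau> v))"
  using perm
  by (auto simp: all_coord all_le_6 phi_simps perm_simps sigma_simps field_hom_simps[OF w])

text \<open>The substitution is an involution on the coordinates, and permuting legs together with
  their parameters carries one Hamiltonian exactly to the other, so \<open>K = 0\<close>.\<close>

theorem perm_automorphism:
  fixes \<theta> \<theta>' :: "'k::field \<Rightarrow> 'k"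
  assumes two: "(2::'k) \<noteq> 0" and perm: "(\<sigma>, \<tau>) \<in> {(\<sigma>1, perm1), (\<sigma>2, perm2)}"
    and \<theta>: "field_hom \<theta>" "field_hom \<theta>'" "\<And>c. \<theta>' (\<theta> c) = c" "\<And>c. \<theta> (\<theta>' c) = c"
    and par: "\<And>j. j \<le> 6 \<Longrightarrow> \<theta> (\<alpha>' j) = \<alpha> (\<sigma> j)"
  obtains w where "field_hom w" "\<And>c. w (Const c) = Const (\<theta> c)" "\<And>v. w (Var v) = Var (\<tau> v)"
    "birational_canonical w" "\<And>f. w (ddt \<alpha>' f) = ddt \<alpha> (w f)"
proof -
  have involution: "\<tau> (\<tau> v) = v" for v
    using perm by (cases v) (auto simp: perm_simps)
  have spec: "specializes (\<lambda>c. Const (\<eta> c)) (\<lambda>v. Var (\<tau> v)) (Var (\<tau> v)) (Var v :: 'k phase)"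
    if "field_hom \<eta>" for \<eta> :: "'k \<Rightarrow> 'k" and v
    using specializes_Var[OF field_hom_compose[OF field_hom_Const that], of "\<lambda>v. Var (\<tau> v)" "\<tau> v"]
    by (simp add: involution)
  obtain w where w: "field_hom w" "bij w" "\<And>c. w (Const c) = Const (\<theta> c)" "\<And>v. w (Var v) = Var (\<tau> v)"
    using ratfun_automorphism[OF \<theta> spec[OF \<theta>(2)] spec[OF \<theta>(1)]] by blast
  have sv: "w sv = sv" using perm by (auto simp: w perm_simps)
  have can: "w (poisson f g) = poisson (w f) (w g)" for f g
  proof (rule poisson_homI[OF w(1,3)])
    show "poisson (w (Var u)) (w (Var v)) = w (poisson (Var u) (Var v))" for u v
      using perm
      by (cases u; cases v; auto simp: w(4) perm_simps poisson_expand pderivative_simps field_hom_simps[OF w(1)])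
  qed
  have par': "w (Const (\<alpha>' j)) = Const (\<alpha> (\<sigma> j))" if "j \<le> 6" for j
    using par[OF that] w(3) by simp
  have "w (hamiltonian \<alpha>') =
      coupled (Var (\<tau> Sv)) (Const (\<alpha> (\<sigma> 3)))
        (Var (\<tau> Q1)) (Var (\<tau> P1)) (Const (\<alpha> (\<sigma> 2))) (Const (\<alpha> (\<sigma> 1)))
        (Var (\<tau> Q2)) (Var (\<tau> P2)) (Const (\<alpha> (\<sigma> 4))) (Const (\<alpha> (\<sigma> 5)))
        (Var (\<tau> Q3)) (Var (\<tau> P3)) (Const (\<alpha> (\<sigma> 6))) (Const (\<alpha> (\<sigma> 0)))"
    by (simp add: hamiltonian_eq_coupled[OF two] field_hom_coupled[OF w(1)] w(4) par')
  also have "\<dots> = hamiltonian \<alpha> + 0"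
    using perm
    by (auto simp: hamiltonian_eq_coupled[OF two] perm_simps sigma_simps coupled_def coupling_def mult_ac add_ac)
  finally have "w (hamiltonian \<alpha>') = hamiltonian \<alpha> + 0" .
  moreover have "poisson 0 (w (Var v)) =
      sv * (sv - 1) * (pderivative Sv (w (Var v)) - w (pderivative Sv (Var v)))" for v
    using perm
    by (cases v; auto simp: w(4) perm_simps poisson_expand pderivative_simps field_hom_simps[OF w(1)])
  ultimately show thesis
    using that[OF w(1,3,4)] w(2) can ddt_intertwined[OF w(1,3) sv can]
    by (simp add: birational_canonical_def)
qed

section \<open>Indeterminate and numerical parameters\<close>

lemma cartan_diagonal: "i \<le> 6 \<Longrightarrow> cartan i i = 2"
  by (elim le_6_cases) (simp_all add: cartan_def)

lemma param_relation_r_param: "param_relation \<alpha> \<Longrightarrow> i \<le> 6 \<Longrightarrow> param_relation (r_param i \<alpha>)"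
  by (elim le_6_cases) (simp_all add: param_relation_def r_param_def cartan_def algebra_simps)

lemma r_param_r_param: "i \<le> 6 \<Longrightarrow> r_param i (r_param i \<alpha>) j = \<alpha> j"
  by (simp add: r_param_def cartan_diagonal algebra_simps)

lemma param_relation_sigma:
  "param_relation \<alpha> \<Longrightarrow> \<sigma> \<in> {\<sigma>1, \<sigma>2} \<Longrightarrow> param_relation (\<alpha> \<circ> \<sigma>)"
  by (auto simp: param_relation_def sigma_simps algebra_simps)

lemma sigma_le_6: "\<sigma> \<in> {\<sigma>1, \<sigma>2} \<Longrightarrow> j \<le> 6 \<Longrightarrow> \<sigma> j \<le> 6"
  and sigma_sigma: "\<sigma> \<in> {\<sigma>1, \<sigma>2} \<Longrightarrow> j \<le> 6 \<Longrightarrow> \<sigma> (\<sigma> j) = j"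
  by (elim le_6_cases; auto simp: sigma_simps)+

section \<open>Automorphisms of the field of parameters\<close>

lemma gen_alpha_simps:
  "gen_alpha 0 = 1 - Var A1 - 2 * Var A2 - 3 * Var A3 - 2 * Var A4 - Var A5 - 2 * Var A6"
  "gen_alpha 1 = Var A1" "gen_alpha 2 = Var A2" "gen_alpha 3 = Var A3" "gen_alpha 4 = Var A4"
  "gen_alpha 5 = Var A5" "gen_alpha 6 = Var A6"
  by (simp_all add: gen_alpha_def)

lemma gen_alpha_avar_rank: "gen_alpha (avar_rank v) = Var v"
  by (cases v) (simp_all add: gen_alpha_def)

lemma avar_rank_le_6: "avar_rank v \<le> 6"
  by (cases v) simp_all

text \<open>Since \<open>gen_alpha 0\<close> was eliminated by the linear relation, the same
  relation for \<open>\<beta>\<close> makes \<open>\<beta> 0\<close> its value.\<close>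

lemma specializes_gen_alpha:
  assumes "param_relation \<beta>" "j \<le> 6"
  shows "specializes Const (\<lambda>v. \<beta> (avar_rank v)) (gen_alpha j) (\<beta> j :: params)"
proof -
  let ?S = "specializes Const (\<lambda>v. \<beta> (avar_rank v))"
  note intros = specializes_intros[OF field_hom_Const]
  have var: "?S (Var v) (\<beta> (avar_rank v))" for v
    by (rule specializes_Var[OF field_hom_Const])
  have "\<beta> 0 = 1 - \<beta> 1 - 2 * \<beta> 2 - 3 * \<beta> 3 - 2 * \<beta> 4 - \<beta> 5 - 2 * \<beta> 6"
    using assms(1) unfolding param_relation_def by (simp add: algebra_simps)
  moreover have "?S (gen_alpha 0) (1 - \<beta> 1 - 2 * \<beta> 2 - 3 * \<beta> 3 - 2 * \<beta> 4 - \<beta> 5 - 2 * \<beta> 6)"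
    unfolding gen_alpha_simps
    using var[of A1] var[of A2] var[of A3] var[of A4] var[of A5] var[of A6] by (auto intro!: intros)
  ultimately show ?thesis
    using var[of A1] var[of A2] var[of A3] var[of A4] var[of A5] var[of A6] \<open>j \<le> 6\<close>
    by (elim le_6_cases) (simp_all add: gen_alpha_def)
qed

text \<open>The second hypothesis says that the substitution undoes itself. This gives both the
  existence of \<open>\<theta>\<close> and its involutivity.\<close>

lemma params_involution:
  assumes rel: "param_relation \<beta>"
    and inv: "\<And>j. j \<le> 6 \<Longrightarrow> specializes Const (\<lambda>v. \<beta> (avar_rank v)) (\<beta> j) (gen_alpha j)"
  obtains \<theta> :: "params \<Rightarrow> params" where "field_hom \<theta>" "\<And>c. \<theta> (\<theta> c) = c" "\<And>c. \<theta> (Const c) = Const c"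
    "\<And>j. j \<le> 6 \<Longrightarrow> \<theta> (gen_alpha j) = \<beta> j"
proof -
  obtain \<theta> :: "params \<Rightarrow> params" where
    \<theta>: "field_hom \<theta>" "\<And>f g. specializes Const (\<lambda>v. \<beta> (avar_rank v)) f g \<longleftrightarrow> \<theta> f = g"
    using ratfun_hom_exists[OF field_hom_id field_hom_id refl,
        of "\<lambda>v. \<beta> (avar_rank v)" "\<lambda>v. \<beta> (avar_rank v)"]
      inv[OF avar_rank_le_6] by (auto simp: gen_alpha_avar_rank)
  have const: "\<theta> (Const c) = Const c" for c
    using \<theta>(2) specializes_Const[OF field_hom_Const] by blast
  have gen: "\<theta> (gen_alpha j) = \<beta> j" "\<theta> (\<beta> j) = gen_alpha j" if "j \<le> 6" for j
    using \<theta>(2) specializes_gen_alpha[OF rel that] inv[OF that] by blast+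
  have "(\<lambda>c. \<theta> (\<theta> c)) = (\<lambda>c. c)"
  proof (rule field_hom_ratfun_eqI)
    show "\<theta> (\<theta> (Var v)) = Var v" for v
      using gen[OF avar_rank_le_6[of v]] by (simp add: gen_alpha_avar_rank)
  qed (simp_all add: field_hom_compose field_hom_id \<theta>(1) const)
  then show thesis using that \<theta>(1) const gen(1) by metis
qed

lemma params_r_param:
  assumes "i \<le> 6"
  obtains \<theta> :: "params \<Rightarrow> params" where "field_hom \<theta>" "\<And>c. \<theta> (\<theta> c) = c" "\<And>c. \<theta> (Const c) = Const c"
    "\<And>j. j \<le> 6 \<Longrightarrow> \<theta> (gen_alpha j) = r_param i gen_alpha j"
proof (rule params_involution)
  let ?\<beta> = "r_param i gen_alpha"
  show rel: "param_relation ?\<beta>"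
    using param_relation_r_param[OF param_relation_gen_alpha assms] .
  show "specializes Const (\<lambda>v. ?\<beta> (avar_rank v)) (?\<beta> j) (gen_alpha j)" if "j \<le> 6" for j
  proof -
    \<comment> \<open>Substituting the reflected parameters into the formula for the reflection
      applies the reflection twice.\<close>
    have spec: "specializes Const (\<lambda>v. ?\<beta> (avar_rank v)) (gen_alpha j - of_int (cartan i j) * gen_alpha i)
        (?\<beta> j - of_int (cartan i j) * ?\<beta> i)"
      by (intro specializes_intros[OF field_hom_Const] specializes_gen_alpha rel assms that)
    have eq: "?\<beta> j - of_int (cartan i j) * ?\<beta> i = gen_alpha j"
      using r_param_r_param[OF assms, of gen_alpha j] by (subst (asm) r_param_def)
    show ?thesis
      using spec unfolding eq by (simp only: r_param_def[of i gen_alpha j])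
  qed
qed (use that in blast)

lemma params_sigma:
  assumes "\<sigma> \<in> {\<sigma>1, \<sigma>2}"
  obtains \<theta> :: "params \<Rightarrow> params" where "field_hom \<theta>" "\<And>c. \<theta> (\<theta> c) = c" "\<And>c. \<theta> (Const c) = Const c"
    "\<And>j. j \<le> 6 \<Longrightarrow> \<theta> (gen_alpha j) = gen_alpha (\<sigma> j)"
proof (rule params_involution)
  let ?\<beta> = "gen_alpha \<circ> \<sigma>"
  show rel: "param_relation ?\<beta>"
    using param_relation_sigma[OF param_relation_gen_alpha assms] .
  show "specializes Const (\<lambda>v. ?\<beta> (avar_rank v)) (?\<beta> j) (gen_alpha j)" if "j \<le> 6" for j
    using specializes_gen_alpha[OF rel sigma_le_6[OF assms that]] by (simp add: sigma_sigma[OF assms that])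
qed (use that in \<open>auto simp: o_def\<close>)

text \<open>The variables of \<open>params\<close> occur among the \<open>gen_alpha j\<close>, so
  the prescribed values determine \<open>w\<close> on all constants. The condition thereby takes the
  shape of the numerical one, with \<open>\<theta>\<close> in place of the identity.\<close>

lemma generic_transf_iff:
  assumes \<theta>: "field_hom \<theta>" "\<And>c. \<theta> (Const c) = Const c" "\<And>j. j \<le> 6 \<Longrightarrow> \<theta> (gen_alpha j) = \<beta> j"
  shows "generic_transf \<beta> \<psi> w \<longleftrightarrow>
    field_hom w \<and> (\<forall>c. w (Const c) = Const (\<theta> c)) \<and> w sv = sv \<and> (\<forall>j\<le>6. w (\<phi> j) = \<psi> j)"
proof -
  have "w (Const c) = Const (\<theta> c)"
    if w: "field_hom w" "\<And>c. w (Const (Const c)) = Const (Const c)"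
      "\<And>j. j \<le> 6 \<Longrightarrow> w (Const (gen_alpha j)) = Const (\<beta> j)" for c
  proof -
    have "(\<lambda>c. w (Const c)) = (\<lambda>c. Const (\<theta> c))"
    proof (rule field_hom_ratfun_eqI)
      show "w (Const (Var v)) = Const (\<theta> (Var v))" for v
        using w(3)[OF avar_rank_le_6[of v]] \<theta>(3)[OF avar_rank_le_6[of v]]
        by (simp add: gen_alpha_avar_rank)
    qed (simp_all add: field_hom_compose field_hom_Const w \<theta>)
    then show ?thesis by metis
  qed
  then show ?thesis unfolding generic_transf_def using \<theta>(2,3) by auto
qed

text \<open>Constants and coordinates determine a homomorphism, so \<open>w\<close> is the only
  solution of \<open>T\<close> and its properties are those of every solution.\<close>

lemma symmetryI:
  assumes T: "\<And>u. T u \<longleftrightarrow> field_hom u \<and> (\<forall>c. u (Const c) = Const (\<theta> c)) \<and> (\<forall>v. u (Var v) = x v)"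
    and w: "field_hom w" "\<And>c. w (Const c) = Const (\<theta> c)" "\<And>v. w (Var v) = x v"
    and sym: "birational_canonical w" "\<And>f. w (d' f) = d (w f)"
  shows "symmetry T d' d"
proof -
  have "T w" by (simp add: T w)
  moreover have "u = w" if "T u" for u
    using that w by (auto simp: T intro: field_hom_ratfun_eqI)
  ultimately show ?thesis unfolding symmetry_def using sym by metis
qed

section \<open>Assembly of the symmetries\<close>

lemma symmetry_shift:
  fixes \<theta> \<theta>' :: "'k::field \<Rightarrow> 'k"
  assumes "(2::'k) \<noteq> 0" "param_relation \<alpha>" and i: "i \<le> 6"
    and "field_hom \<theta>" "field_hom \<theta>'" "\<And>c. \<theta>' (\<theta> c) = c" "\<And>c. \<theta> (\<theta>' c) = c"
    and "\<And>j. j \<le> 6 \<Longrightarrow> \<theta> (\<alpha>' j) = r_param i \<alpha> j"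
    and T: "\<And>w. T w \<longleftrightarrow> field_hom w \<and> (\<forall>c. w (Const c) = Const (\<theta> c)) \<and> w sv = sv \<and> (\<forall>j\<le>6. w (\<phi> j) = r_phi i \<alpha> j)"
  shows "symmetry T (ddt \<alpha>') (ddt \<alpha>)"
proof -
  obtain w where w: "field_hom w" "\<And>c. w (Const c) = Const (\<theta> c)" "\<And>v. w (Var v) = shift i (\<alpha> i) v"
    "birational_canonical w" "\<And>f. w (ddt \<alpha>' f) = ddt \<alpha> (w f)"
    using shift_automorphism[OF assms(1-8)] by blast
  show ?thesis
    by (rule symmetryI[where d' = "ddt \<alpha>'" and d = "ddt \<alpha>", OF _ w]) (use T r_phi_iff_shift[OF _ i] in blast)
qed

lemma symmetry_perm:
  fixes \<theta> \<theta>' :: "'k::field \<Rightarrow> 'k"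
  assumes "(2::'k) \<noteq> 0" and \<sigma>: "\<sigma> \<in> {\<sigma>1, \<sigma>2}"
    and \<theta>: "field_hom \<theta>" "field_hom \<theta>'" "\<And>c. \<theta>' (\<theta> c) = c" "\<And>c. \<theta> (\<theta>' c) = c"
    and par: "\<And>j. j \<le> 6 \<Longrightarrow> \<theta> (\<alpha>' j) = \<alpha> (\<sigma> j)"
    and T: "\<And>w. T w \<longleftrightarrow> field_hom w \<and> (\<forall>c. w (Const c) = Const (\<theta> c)) \<and> w sv = sv \<and> (\<forall>j\<le>6. w (\<phi> j) = (\<phi> \<circ> \<sigma>) j)"
  shows "symmetry T (ddt \<alpha>') (ddt \<alpha>)"
proof -
  obtain \<tau> where perm: "(\<sigma>, \<tau>) \<in> {(\<sigma>1, perm1), (\<sigma>2, perm2)}" using \<sigma> by blast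
  obtain w where w: "field_hom w" "\<And>c. w (Const c) = Const (\<theta> c)" "\<And>v. w (Var v) = Var (\<tau> v)"
    "birational_canonical w" "\<And>f. w (ddt \<alpha>' f) = ddt \<alpha> (w f)"
    using perm_automorphism[where \<alpha> = \<alpha> and \<alpha>' = \<alpha>', OF assms(1) perm \<theta> par] by blast
  show ?thesis
    by (rule symmetryI[where d' = "ddt \<alpha>'" and d = "ddt \<alpha>", OF _ w]) (use T phi_sigma_iff_perm[OF _ perm] in blast)
qed

theorem theorem1p1:
  shows "((\<forall>i\<le>6. symmetry (generic_transf (r_param i gen_alpha) (r_phi i gen_alpha))
                    (ddt gen_alpha) (ddt gen_alpha))
          \<and> (\<forall>\<sigma>\<in>{\<sigma>1, \<sigma>2}. symmetry (generic_transf (gen_alpha \<circ> \<sigma>) (\<phi> \<circ> \<sigma>))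
                    (ddt gen_alpha) (ddt gen_alpha)))
    \<and> (\<forall>\<alpha> :: nat \<Rightarrow> complex. param_relation \<alpha> \<longrightarrow>
          (\<forall>i\<le>6. symmetry (numeric_transf (r_phi i \<alpha>)) (ddt (r_param i \<alpha>)) (ddt \<alpha>))
          \<and> (\<forall>\<sigma>\<in>{\<sigma>1, \<sigma>2}. symmetry (numeric_transf (\<phi> \<circ> \<sigma>)) (ddt (\<alpha> \<circ> \<sigma>)) (ddt \<alpha>)))"
proof (intro conjI allI ballI impI)
  have two: "(2::params) \<noteq> 0"
    using field_hom_simps(12)[OF field_hom_Const, of "2::complex"]
    by (simp add: field_hom_simps[OF field_hom_Const])
  fix i :: nat assume i: "i \<le> 6"
  obtain \<theta> :: "params \<Rightarrow> params" where \<theta>: "field_hom \<theta>" "\<And>c. \<theta> (\<theta> c) = c" "\<And>c. \<theta> (Const c) = Const c"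
    "\<And>j. j \<le> 6 \<Longrightarrow> \<theta> (gen_alpha j) = r_param i gen_alpha j"
    using params_r_param[OF i] by blast
  \<comment> \<open>The involution \<open>\<theta>\<close> serves as its own inverse, and both
    derivations carry the parameters \<open>gen_alpha\<close>.\<close>
  show "symmetry (generic_transf (r_param i gen_alpha) (r_phi i gen_alpha)) (ddt gen_alpha) (ddt gen_alpha)"
    by (rule symmetry_shift[OF two param_relation_gen_alpha i \<theta>(1,1,2,2,4) generic_transf_iff[OF \<theta>(1,3,4)]])
next
  have two: "(2::params) \<noteq> 0"
    using field_hom_simps(12)[OF field_hom_Const, of "2::complex"]
    by (simp add: field_hom_simps[OF field_hom_Const])
  fix \<sigma> assume \<sigma>: "\<sigma> \<in> {\<sigma>1, \<sigma>2}"
  obtain \<theta> :: "params \<Rightarrow> params" where \<theta>: "field_hom \<theta>" "\<And>c. \<theta> (\<theta> c) = c" "\<And>c. \<theta> (Const c) = Const c"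
    "\<And>j. j \<le> 6 \<Longrightarrow> \<theta> (gen_alpha j) = gen_alpha (\<sigma> j)"
    using params_sigma[OF \<sigma>] by blast
  have T: "generic_transf (gen_alpha \<circ> \<sigma>) (\<phi> \<circ> \<sigma>) w \<longleftrightarrow>
      field_hom w \<and> (\<forall>c. w (Const c) = Const (\<theta> c)) \<and> w sv = sv \<and> (\<forall>j\<le>6. w (\<phi> j) = (\<phi> \<circ> \<sigma>) j)" for w
    by (rule generic_transf_iff) (simp_all add: \<theta>)
  show "symmetry (generic_transf (gen_alpha \<circ> \<sigma>) (\<phi> \<circ> \<sigma>)) (ddt gen_alpha) (ddt gen_alpha)"
    by (rule symmetry_perm[where \<alpha> = gen_alpha and \<alpha>' = gen_alpha, OF two \<sigma> \<theta>(1,1,2,2,4) T])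
next
  \<comment> \<open>For numerical values \<open>\<theta>\<close> is the identity, and the change of
    parameters lies entirely in the first derivation.\<close>
  fix \<alpha> :: "nat \<Rightarrow> complex" and i :: nat assume "param_relation \<alpha>" "i \<le> 6"
  then show "symmetry (numeric_transf (r_phi i \<alpha>)) (ddt (r_param i \<alpha>)) (ddt \<alpha>)"
    by (intro symmetry_shift[where \<theta> = "\<lambda>c. c" and \<theta>' = "\<lambda>c. c"])
      (simp_all add: field_hom_id numeric_transf_def)
next
  fix \<alpha> :: "nat \<Rightarrow> complex" and \<sigma> assume "\<sigma> \<in> {\<sigma>1, \<sigma>2}"
  then show "symmetry (numeric_transf (\<phi> \<circ> \<sigma>)) (ddt (\<alpha> \<circ> \<sigma>)) (ddt \<alpha>)"
    by (intro symmetry_perm[where \<theta> = "\<lambda>c. c" and \<theta>' = "\<lambda>c. c"])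
      (simp_all add: field_hom_id numeric_transf_def)
qed

end
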